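(* Let $f\in\Lambda_{d,\bar p'}$, i.e. $f(z)=\sigma z+b+P(z)/Q(z)$ is of degree $d\ge2$, and let $v_1,\dots,v_p$ be the critical values $v_k=f(c_k)$ that are different from $\infty$. Given $z\in\mathbf C$, let $l(z)$ be the minimal $l$ such that $f^l(z)=\infty$, and $l(z)=\infty$ if there is no such $l$. Then (as formal power series in $\lambda$) $$\varphi_{z,\lambda}(x)-\lambda\,(T_f\varphi_{z,\lambda})(x)=\frac1{z-x}+\sum_{k=1}^{p}\frac1{v_k-x}\,\Phi_k(\lambda,z),$$ where $$\varphi_{z,\lambda}(x)=\sum_{n=0}^{l(z)-1}\frac{\lambda^n}{(f^n)'(z)}\,\frac1{f^n(z)-x},\qquad \Phi_k(\lambda,z)=\sum_{n=0}^{l(z)-1}\lambda^{n+1}\frac{\frac{\partial f}{\partial v_k}(f^n(z))}{(f^{n+1})'(z)},$$ for $z$ that is not a critical point of any iterate $f^n$, and $x\in\mathbf C$ not a critical value of $f$ and different from all $f^n(z)$. (If $l(z)<\infty$, the term $n=l(z)-1$ of $\Phi_k$ is understood as $\lambda^{n+1}\frac{1}{(f^n)'(z)}$ times the value at $f^n(z)$ of the meromorphic function $\frac{\partial f}{\partial v_k}/f'$.)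
   Context: $T_f\psi(x)=\sum_{w:f(w)=x}\frac{\psi(w)}{(f'(w))^2}$ (for $x$ not a critical value of $f$), applied in the variable $x$ and termwise in $\lambda$. For $f(z)=\sigma z+b+P(z)/Q(z)$ with $\sigma\neq0$, $Q$ monic of degree $d-1$, $\deg P\le d-2$, $P,Q$ coprime, let $c_1,\dots,c_{p'}$ be the distinct critical points (all in $\mathbf C$), $\bar p'=\{m_1,\dots,m_{p'}\}$ their multiplicities, $v_j=f(c_j)$, ordered so that $v_j\in\mathbf C$ for $j\le p$ and $v_j=\infty$ for $p<j\le p'$. $\Lambda_{d,\bar p'}$ is the set of maps $g(z)=\sigma(g)z+b(g)+P_g(z)/Q_g(z)$ of the same form with coefficients close to those of $f$, having exactly $p'$ distinct critical points $c_j(g)$, close to $c_j$ and of multiplicity $m_j$; $v_j(g)=g(c_j(g))$. It is known to be a complex manifold of dimension $p'+2$ with local holomorphic coordinate $\bar v(g)=(\sigma(g),b(g),v_1(g),\dots,v_p(g),1/v_{p+1}(g),\dots,1/v_{p'}(g))$. For $k\le p$, $\frac{\partial f}{\partial v_k}(z)$ denotes the partial derivative of $g(z)$ ($z$ fixed) with respect to the coordinate $v_k(g)$, evaluated at $g=f$. $f^n$ is the $n$-th iterate and $'$ the derivative in $z$. *)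

theory Defs
  imports "HOL-Complex_Analysis.Complex_Analysis"
begin

text \<open>The Riemann sphere is \<open>complex option\<close>, with \<open>None\<close> for the point at infinity.\<close>

type_synonym csphere = "complex option"

text \<open>The affine chart (arbitrary at infinity) and the chart at infinity.\<close>

definition aff :: "(csphere \<Rightarrow> csphere) \<Rightarrow> complex \<Rightarrow> complex" where
  "aff h z = the (h (Some z))"

fun recip :: "csphere \<Rightarrow> complex" where
  "recip None = 0"
| "recip (Some w) = 1 / w"

text \<open>Near \<open>z\<close>, the map \<open>h\<close> read in a chart of the sphere around the value of \<open>h\<close> at \<open>z\<close>.
  Critical points, including those with infinite value, are the zeros of the derivative of this
  function, and their multiplicity is the order of that zero.\<close>

definition chart_rep :: "(csphere \<Rightarrow> csphere) \<Rightarrow> complex \<Rightarrow> complex \<Rightarrow> complex" where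
  "chart_rep h z = (if h (Some z) = None then (\<lambda>w. recip (h (Some w))) else aff h)"

definition crit_point :: "(csphere \<Rightarrow> csphere) \<Rightarrow> complex \<Rightarrow> bool" where
  "crit_point h z \<longleftrightarrow> deriv (chart_rep h z) z = 0"

definition crit_mult :: "(csphere \<Rightarrow> csphere) \<Rightarrow> complex \<Rightarrow> int" where
  "crit_mult h z = zorder (deriv (chart_rep h z)) z"

text \<open>\<open>RatMap \<sigma> b P Q\<close> stands for the map \<open>\<sigma> z + b + P(z) / Q(z)\<close>; under
  \<open>normal_form\<close> the data are determined by the map, whose degree is \<open>d\<close>.\<close>

datatype ratmap =
  RatMap (rsigma: complex) (rconst: complex) (rnum: "complex poly") (rden: "complex poly")

definition normal_form :: "nat \<Rightarrow> ratmap \<Rightarrow> bool" where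
  "normal_form d g \<longleftrightarrow> rsigma g \<noteq> 0 \<and> lead_coeff (rden g) = 1 \<and> degree (rden g) = d - 1 \<and>
     degree (rnum g) \<le> d - 2 \<and> coprime (rnum g) (rden g)"

fun rmap :: "ratmap \<Rightarrow> csphere \<Rightarrow> csphere" where
  "rmap g None = None"
| "rmap g (Some z) = (if poly (rden g) z = 0 then None
     else Some (rsigma g * z + rconst g + poly (rnum g) z / poly (rden g) z))"

text \<open>In the following, \<open>c\<close> enumerates the distinct critical points of \<open>f\<close> by a finite type
  \<open>'n\<close>, so that \<open>CARD('n)\<close> is their number, and \<open>\<epsilon>\<close> quantifies closeness to \<open>f\<close>.
  A marking \<open>a\<close> is the enumeration of the critical points of \<open>g\<close> close to the one of \<open>f\<close>.\<close>

definition is_marking ::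
    "ratmap \<Rightarrow> ('n::finite \<Rightarrow> complex) \<Rightarrow> real \<Rightarrow> ratmap \<Rightarrow> ('n \<Rightarrow> complex) \<Rightarrow> bool" where
  "is_marking f c \<epsilon> g a \<longleftrightarrow> inj a \<and> range a = {w. crit_point (rmap g) w} \<and>
     (\<forall>j. dist (a j) (c j) < \<epsilon> \<and> crit_mult (rmap g) (a j) = crit_mult (rmap f) (c j))"

definition marking :: "ratmap \<Rightarrow> ('n::finite \<Rightarrow> complex) \<Rightarrow> real \<Rightarrow> ratmap \<Rightarrow> 'n \<Rightarrow> complex" where
  "marking f c \<epsilon> g = (THE a. is_marking f c \<epsilon> g a)"

definition Lambda :: "nat \<Rightarrow> ratmap \<Rightarrow> ('n::finite \<Rightarrow> complex) \<Rightarrow> real \<Rightarrow> ratmap set" where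
  "Lambda d f c \<epsilon> = {g. normal_form d g \<and>
     dist (rsigma g) (rsigma f) < \<epsilon> \<and> dist (rconst g) (rconst f) < \<epsilon> \<and>
     (\<forall>i. dist (coeff (rnum g) i) (coeff (rnum f) i) < \<epsilon>) \<and>
     (\<forall>i. dist (coeff (rden g) i) (coeff (rden f) i) < \<epsilon>) \<and>
     (\<exists>a. is_marking f c \<epsilon> g a)}"

definition vbar ::
    "ratmap \<Rightarrow> ('n::finite \<Rightarrow> complex) \<Rightarrow> real \<Rightarrow> ratmap \<Rightarrow> complex \<times> complex \<times> (complex ^ 'n)" where
  "vbar f c \<epsilon> g = (rsigma g, rconst g,
     \<chi> j. if rmap f (Some (c j)) \<noteq> None then aff (rmap g) (marking f c \<epsilon> g j)
          else recip (rmap g (Some (marking f c \<epsilon> g j))))"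

definition vbar_inv ::
    "nat \<Rightarrow> ratmap \<Rightarrow> ('n::finite \<Rightarrow> complex) \<Rightarrow> real \<Rightarrow> complex \<times> complex \<times> (complex ^ 'n) \<Rightarrow> ratmap" where
  "vbar_inv d f c \<epsilon> = inv_into (Lambda d f c \<epsilon>) (vbar f c \<epsilon>)"

text \<open>Holomorphy in several variables: real differentiability with complex linear derivative.\<close>

definition mv_holomorphic_on ::
    "(complex \<times> complex \<times> (complex ^ 'n) \<Rightarrow> complex) \<Rightarrow>
     (complex \<times> complex \<times> (complex ^ 'n::finite)) set \<Rightarrow> bool" where
  "mv_holomorphic_on h U \<longleftrightarrow> (\<forall>u\<in>U. \<exists>\<alpha> \<beta> \<gamma>.
     (h has_derivative (\<lambda>(s, b, v). \<alpha> * s + \<beta> * b + (\<Sum>j\<in>UNIV. \<gamma> j * v $ j))) (at u))"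

text \<open>\<open>vbar\<close> is a holomorphic coordinate on the \<open>\<epsilon>\<close>-neighbourhood of \<open>f\<close>: it maps this
  neighbourhood bijectively to an open set, and the coefficients of \<open>g\<close> are holomorphic functions
  of \<open>vbar g\<close>. The discs of radius \<open>\<epsilon>\<close> about the critical points of \<open>f\<close> are required to be
  disjoint, so that markings are unique.\<close>

definition local_coordinate :: "nat \<Rightarrow> ratmap \<Rightarrow> ('n::finite \<Rightarrow> complex) \<Rightarrow> real \<Rightarrow> bool" where
  "local_coordinate d f c \<epsilon> \<longleftrightarrow>
     \<epsilon> > 0 \<and> (\<forall>i j. i \<noteq> j \<longrightarrow> ball (c i) \<epsilon> \<inter> ball (c j) \<epsilon> = {}) \<and>
     inj_on (vbar f c \<epsilon>) (Lambda d f c \<epsilon>) \<and>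
     open (vbar f c \<epsilon> ` Lambda d f c \<epsilon>) \<and>
     mv_holomorphic_on (\<lambda>u. rsigma (vbar_inv d f c \<epsilon> u)) (vbar f c \<epsilon> ` Lambda d f c \<epsilon>) \<and>
     mv_holomorphic_on (\<lambda>u. rconst (vbar_inv d f c \<epsilon> u)) (vbar f c \<epsilon> ` Lambda d f c \<epsilon>) \<and>
     (\<forall>i. mv_holomorphic_on (\<lambda>u. coeff (rnum (vbar_inv d f c \<epsilon> u)) i) (vbar f c \<epsilon> ` Lambda d f c \<epsilon>)) \<and>
     (\<forall>i. mv_holomorphic_on (\<lambda>u. coeff (rden (vbar_inv d f c \<epsilon> u)) i) (vbar f c \<epsilon> ` Lambda d f c \<epsilon>))"

text \<open>The partial derivative of \<open>g(z)\<close>, for fixed \<open>z\<close>, with respect to the coordinate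
  \<open>v\<^sub>k(g)\<close>, at \<open>g = f\<close>.\<close>

definition dfdv :: "nat \<Rightarrow> ratmap \<Rightarrow> ('n::finite \<Rightarrow> complex) \<Rightarrow> real \<Rightarrow> 'n \<Rightarrow> complex \<Rightarrow> complex" where
  "dfdv d f c \<epsilon> k z =
     deriv (\<lambda>t. aff (rmap (vbar_inv d f c \<epsilon> (vbar f c \<epsilon> f + (0, 0, axis k t)))) z) 0"

definition transfer_op :: "ratmap \<Rightarrow> (complex \<Rightarrow> complex) \<Rightarrow> complex \<Rightarrow> complex" where
  "transfer_op f \<psi> x =
     (\<Sum>w\<in>{w. rmap f (Some w) = Some x}. \<psi> w / (deriv (aff (rmap f)) w)\<^sup>2)"

definition transfer_fps :: "ratmap \<Rightarrow> (complex \<Rightarrow> complex fps) \<Rightarrow> complex \<Rightarrow> complex fps" where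
  "transfer_fps f \<Psi> x = Abs_fps (\<lambda>n. transfer_op f (\<lambda>w. fps_nth (\<Psi> w) n) x)"

definition escape_time :: "ratmap \<Rightarrow> complex \<Rightarrow> enat" where
  "escape_time f z = (if \<exists>l. (rmap f ^^ l) (Some z) = None
     then enat (LEAST l. (rmap f ^^ l) (Some z) = None) else \<infinity>)"

definition iter :: "ratmap \<Rightarrow> nat \<Rightarrow> complex \<Rightarrow> complex" where
  "iter f n = aff (rmap f ^^ n)"

definition phi :: "ratmap \<Rightarrow> complex \<Rightarrow> complex \<Rightarrow> complex fps" where
  "phi f z x = Abs_fps (\<lambda>n. if enat n < escape_time f z
     then 1 / deriv (iter f n) z * (1 / (iter f n z - x)) else 0)"

text \<open>In the last term before escape, \<open>iter f n z\<close> is a pole of \<open>f\<close>, and the value there of the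
  meromorphic function \<open>dfdv / f'\<close> is its limit.\<close>

definition Phi ::
    "nat \<Rightarrow> ratmap \<Rightarrow> ('n::finite \<Rightarrow> complex) \<Rightarrow> real \<Rightarrow> 'n \<Rightarrow> complex \<Rightarrow> complex fps" where
  "Phi d f c \<epsilon> k z = fps_X * Abs_fps (\<lambda>n.
     if enat (Suc n) < escape_time f z
       then dfdv d f c \<epsilon> k (iter f n z) / deriv (iter f (Suc n)) z
     else if enat (Suc n) = escape_time f z
       then 1 / deriv (iter f n) z *
         Lim (at (iter f n z)) (\<lambda>u. dfdv d f c \<epsilon> k u / deriv (aff (rmap f)) u)
     else 0)"

end

theory Submission
  imports Defs "HOL-Computational_Algebra.Fundamental_Theorem_Algebra"
begin

text \<open>Write \<open>f = N / Q\<close> in lowest terms, \<open>f' = W / Q\<^sup>2\<close> with \<open>W = N' Q - N Q'\<close>, and \<open>M = N - x Q\<close>. Comparing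
  coefficients of \<open>\<lambda>\<close>, the claim is the partial fraction expansion in \<open>y = f\<^sup>n(z)\<close> of
  \<open>1 / (f'(y) (f(y) - x)) = Q\<^sup>3 / (W M)\<close>: the simple poles at the preimages \<open>w\<close> of \<open>x\<close> give the
  transfer operator, and the principal part at a critical point \<open>c\<^sub>k\<close> with finite value is that of
  \<open>1 / f'\<close> divided by \<open>v\<^sub>k - x\<close>.

  It remains to see that \<open>(\<partial>f/\<partial>v\<^sub>k) / f'\<close> is the principal part of \<open>1 / f'\<close> at \<open>c\<^sub>k\<close>. Moving the
  coordinate \<open>v\<^sub>k\<close> by \<open>t\<close>, the numerator of \<open>g\<^sub>t - v\<^sub>j(t)\<close> (or the denominator of \<open>g\<^sub>t\<close>, if \<open>c\<^sub>j\<close> is a pole)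
  keeps a root of order \<open>m\<^sub>j + 1\<close> close to \<open>c\<^sub>j\<close>. Hence its \<open>t\<close>-derivative vanishes to order \<open>m\<^sub>j\<close>
  at \<open>c\<^sub>j\<close>, so that \<open>\<partial>f/\<partial>v\<^sub>k = H / Q\<^sup>2\<close>, where \<open>H - Q\<^sup>2\<close> (for \<open>j = k\<close>) or \<open>H\<close> (for \<open>j \<noteq> k\<close>) vanishes to
  order \<open>m\<^sub>j\<close> at \<open>c\<^sub>j\<close>. The two sides of the expansion, multiplied by \<open>W M\<close>, then differ by a
  polynomial of degree less than that of \<open>W M\<close> which vanishes at all roots of \<open>W M\<close> with
  multiplicity.\<close>

section \<open>Root orders and derivatives of complex polynomials\<close>

text \<open>Over the complex numbers the degree counts the roots with multiplicity. This serves to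
  show that a polynomial with too many roots for its degree is zero.\<close>

lemma degree_le_if_order_le:
  fixes p q :: "complex poly"
  assumes "p \<noteq> 0" "q \<noteq> 0" "\<And>a. order a p \<le> order a q"
  shows "degree p \<le> degree q"
proof -
  have "proots p \<subseteq># proots q"
    using assms by (simp add: subseteq_mset_def)
  from size_mset_mono[OF this] show ?thesis
    by (simp add: size_proots_complex)
qed

lemma root_power_dvd_if_order_Suc:
  "order a p = Suc n \<Longrightarrow> [:-a, 1:] ^ n dvd p"
  by (simp add: order_divides)

lemma poly_eq_sum_coeff:
  fixes p :: "complex poly"
  assumes "degree p \<le> D"
  shows "poly p u = (\<Sum>i\<le>D. coeff p i * u ^ i)"
  unfolding poly_altdef using assms by (intro sum.mono_neutral_left) (auto intro: coeff_eq_0)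

text \<open>If \<open>A = (X - c)^(m+1) S\<close>, then \<open>A' B\<close> has order exactly
  \<open>m\<close> at \<open>c\<close>, because \<open>m + 1\<close> is nonzero in characteristic 0,
  while \<open>A B'\<close> has order at least \<open>m + 1\<close>. This links the multiplicity of
  a critical point to a root order of a numerator or denominator.\<close>

lemma order_wronskian:
  fixes A B :: "complex poly"
  assumes "A \<noteq> 0" "poly A c = 0" "poly B c \<noteq> 0"
  shows "order c A = Suc (order c (pderiv A * B - A * pderiv B))"
proof -
  obtain S where S: "A = [:-c, 1:] ^ order c A * S" "\<not> [:-c, 1:] dvd S"
    using order_decomp[OF assms(1)] by blast
  from assms obtain m where m: "order c A = Suc m"
    using order_root not0_implies_Suc by blast
  define T where "T = (smult (of_nat (Suc m)) S + [:-c, 1:] * pderiv S) * B - [:-c, 1:] * S * pderiv B"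
  have A: "A = [:-c, 1:] ^ Suc m * S"
    using S m by simp
  have "pderiv A = [:-c, 1:] ^ m * (smult (of_nat (Suc m)) S + [:-c, 1:] * pderiv S)"
    unfolding A pderiv_mult pderiv_power_Suc by (simp add: pderiv_pCons algebra_simps)
  hence eq: "pderiv A * B - A * pderiv B = [:-c, 1:] ^ m * T"
    unfolding T_def by (subst (2) A) (simp only: power_Suc algebra_simps)
  have "poly S c \<noteq> 0"
    using S(2) by (simp add: poly_eq_0_iff_dvd)
  hence T: "poly T c \<noteq> 0"
    using assms(3) by (simp add: T_def del: of_nat_Suc)
  hence "T \<noteq> 0" by auto
  hence "order c ([:-c, 1:] ^ m * T) = m"
    by (subst order_mult) (use T in \<open>auto simp: order_power_n_n order_0I\<close>)
  with eq m show ?thesis by simp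
qed

text \<open>Induction on \<open>m\<close>: a nonzero derivative has root order exactly one less, and
  a constant polynomial with a root is zero.\<close>

lemma power_dvd_if_pderiv_vanish:
  fixes p :: "complex poly"
  assumes "\<And>i. i < m \<Longrightarrow> poly ((pderiv ^^ i) p) c = 0"
  shows "[:-c, 1:] ^ m dvd p"
  using assms
proof (induction m arbitrary: p)
  case (Suc m)
  have "poly ((pderiv ^^ i) (pderiv p)) c = 0" if "i < m" for i
    using Suc.prems[of "Suc i"] that by (simp add: funpow_swap1)
  hence dvd: "[:-c, 1:] ^ m dvd pderiv p" by (rule Suc.IH)
  have 0: "poly p c = 0" using Suc.prems[of 0] by simp
  show ?case
  proof (cases "pderiv p = 0")
    case True
    then obtain h where "p = [:h:]" using pderiv_iszero by blast
    with 0 show ?thesis by simp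
  next
    case False
    hence "p \<noteq> 0" by auto
    with order_pderiv[OF this 0] dvd False show ?thesis
      by (simp add: order_divides del: power_Suc)
  qed
qed simp

text \<open>One differentiation turns \<open>(X - c)^(k+1) T\<close> into
  \<open>(X - c)^k ((k+1) T + (X - c) T')\<close>, whose cofactor is again nonzero at
  \<open>c\<close>.\<close>

lemma pderiv_funpow_root_power:
  fixes S :: "complex poly"
  assumes "poly S c \<noteq> 0" "i \<le> m"
  obtains T where "(pderiv ^^ i) ([:-c, 1:] ^ m * S) = [:-c, 1:] ^ (m - i) * T" "poly T c \<noteq> 0"
  using assms(2)
proof (induction i arbitrary: thesis)
  case 0
  show ?case by (rule 0) (use assms in auto)
next
  case (Suc i)
  then obtain T where T: "(pderiv ^^ i) ([:-c, 1:] ^ m * S) = [:-c, 1:] ^ (m - i) * T" "poly T c \<noteq> 0"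
    by (metis Suc_leD)
  from Suc.prems obtain k where k: "m - i = Suc k" "m - Suc i = k"
    by (metis Suc_diff_le Suc_le_eq diff_Suc_Suc)
  have "(pderiv ^^ Suc i) ([:-c, 1:] ^ m * S) = [:-c, 1:] ^ k * (smult (of_nat (Suc k)) T + [:-c, 1:] * pderiv T)"
    using T(1) unfolding k by (simp add: pderiv_mult pderiv_power_Suc pderiv_pCons algebra_simps del: power_Suc of_nat_Suc) (simp add: algebra_simps)
  moreover have "poly (smult (of_nat (Suc k)) T + [:-c, 1:] * pderiv T) c \<noteq> 0"
    using T(2) by (simp del: of_nat_Suc)
  ultimately show ?case using Suc.prems(1) k by metis
qed

lemma pderiv_funpow_vanish:
  fixes p :: "complex poly"
  assumes "[:-c, 1:] ^ m dvd p" "i < m"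
  shows "poly ((pderiv ^^ i) p) c = 0"
proof (cases "p = 0")
  case True
  have "(pderiv ^^ i) (0 :: complex poly) = 0" by (induction i) auto
  with True show ?thesis by simp
next
  case False
  obtain S where S: "p = [:-c, 1:] ^ order c p * S" "\<not> [:-c, 1:] dvd S"
    using order_decomp[OF False] by blast
  have "m \<le> order c p" using assms False by (simp add: order_divides)
  with assms(2) have i: "i \<le> order c p" "order c p - i \<noteq> 0" by auto
  obtain T where "(pderiv ^^ i) ([:-c, 1:] ^ order c p * S) = [:-c, 1:] ^ (order c p - i) * T"
    using pderiv_funpow_root_power[OF _ i(1)] S(2) poly_eq_0_iff_dvd by metis
  with S(1) i(2) show ?thesis by simp
qed

text \<open>On the compact set left after removing a small disc about \<open>c\<close>, the modulus
  of \<open>h\<close> has a positive minimum, which the values \<open>h (a t)\<close> eventually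
  undercut.\<close>

lemma tendsto_isolated_zero:
  fixes h :: "complex \<Rightarrow> complex"
  assumes "continuous_on (cball c e) h" "\<And>w. w \<in> cball c e \<Longrightarrow> h w = 0 \<Longrightarrow> w = c"
    and "eventually (\<lambda>t. a t \<in> cball c e) F" "((\<lambda>t. h (a t)) \<longlongrightarrow> 0) F"
  shows "(a \<longlongrightarrow> c) F"
proof (rule tendstoI)
  fix r :: real assume r: "r > 0"
  define K where "K = cball c e - ball c r"
  have K: "compact K" unfolding K_def by (intro compact_diff) auto
  show "eventually (\<lambda>t. dist (a t) c < r) F"
  proof (cases "K = {}")
    case True
    with assms(3) show ?thesis
      unfolding K_def by (auto elim!: eventually_mono simp: dist_commute subset_iff)
  next
    case False
    have "continuous_on K (\<lambda>w. norm (h w))"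
      using assms(1) unfolding K_def by (intro continuous_on_norm) (auto intro: continuous_on_subset)
    from continuous_attains_inf[OF K False this] obtain w where
      w: "w \<in> K" "\<And>v. v \<in> K \<Longrightarrow> norm (h w) \<le> norm (h v)" by blast
    have "h w \<noteq> 0" using w(1) assms(2)[of w] r by (auto simp: K_def)
    hence "eventually (\<lambda>t. norm (h (a t)) < norm (h w)) F"
      using tendstoD[OF assms(4), of "norm (h w)"] by simp
    with assms(3) show ?thesis
    proof eventually_elim
      case (elim t)
      hence "a t \<notin> K" using w(2)[of "a t"] by auto
      with elim(1) show ?case by (auto simp: K_def dist_commute)
    qed
  qed
qed

lemma has_field_derivative_eventually_const:
  assumes "eventually (\<lambda>t. h t = C) (nhds a)"
  shows "(h has_field_derivative 0) (at a)"
  using assms by (subst DERIV_cong_ev[OF refl _ refl, where g = "\<lambda>_. C"]) auto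

subsection \<open>Differentiable families of polynomials\<close>

text \<open>The degree bound near 0 makes evaluation a sum over a fixed finite index set, so that
  limits can be taken term by term.\<close>

definition poly_has_derivative :: "(complex \<Rightarrow> complex poly) \<Rightarrow> complex poly \<Rightarrow> bool" where
  "poly_has_derivative R R' \<longleftrightarrow>
     (\<forall>i. ((\<lambda>t. coeff (R t) i) has_field_derivative coeff R' i) (at 0)) \<and>
     (\<exists>D. eventually (\<lambda>t. degree (R t) \<le> D) (nhds 0))"

lemma poly_has_derivative_coeff:
  "poly_has_derivative R R' \<Longrightarrow> ((\<lambda>t. coeff (R t) i) has_field_derivative coeff R' i) (at 0)"
  by (simp add: poly_has_derivative_def)

lemma poly_has_derivative_degree:
  assumes "poly_has_derivative R R'"
  obtains D where "eventually (\<lambda>t. degree (R t) \<le> D) (nhds 0)"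
  using assms by (auto simp: poly_has_derivative_def)

lemma poly_has_derivative_degree_le:
  assumes "poly_has_derivative R R'" "eventually (\<lambda>t. degree (R t) \<le> D) (nhds 0)"
  shows "degree R' \<le> D"
proof (rule degree_le, intro allI impI)
  fix i assume i: "D < i"
  have "eventually (\<lambda>t. coeff (R t) i = 0) (nhds 0)"
    using assms(2) by eventually_elim (use i in \<open>auto intro: coeff_eq_0\<close>)
  hence "((\<lambda>t. coeff (R t) i) has_field_derivative 0) (at 0)"
    by (rule has_field_derivative_eventually_const)
  with poly_has_derivative_coeff[OF assms(1), of i] show "coeff R' i = 0"
    using DERIV_unique by blast
qed

lemma poly_has_derivative_const: "poly_has_derivative (\<lambda>_. p) 0"
  by (auto simp: poly_has_derivative_def intro!: exI[of _ "degree p"])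

lemma poly_has_derivative_add:
  assumes "poly_has_derivative R R'" "poly_has_derivative S S'"
  shows "poly_has_derivative (\<lambda>t. R t + S t) (R' + S')"
proof -
  obtain D E where DE: "eventually (\<lambda>t. degree (R t) \<le> D) (nhds 0)" "eventually (\<lambda>t. degree (S t) \<le> E) (nhds 0)"
    using assms poly_has_derivative_degree by metis
  hence "eventually (\<lambda>t. degree (R t + S t) \<le> max D E) (nhds 0)"
    by eventually_elim (metis degree_add_le max.coboundedI1 max.coboundedI2)
  with assms show ?thesis
    unfolding poly_has_derivative_def by (auto intro!: DERIV_add)
qed

lemma poly_has_derivative_mult:
  assumes "poly_has_derivative R R'" "poly_has_derivative S S'"
  shows "poly_has_derivative (\<lambda>t. R t * S t) (R' * S 0 + R 0 * S')"
proof -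
  obtain D E where DE: "eventually (\<lambda>t. degree (R t) \<le> D) (nhds 0)" "eventually (\<lambda>t. degree (S t) \<le> E) (nhds 0)"
    using assms poly_has_derivative_degree by metis
  hence "eventually (\<lambda>t. degree (R t * S t) \<le> D + E) (nhds 0)"
    by eventually_elim (meson add_mono degree_mult_le order_trans)
  moreover have "((\<lambda>t. coeff (R t * S t) i) has_field_derivative coeff (R' * S 0 + R 0 * S') i) (at 0)" for i
    unfolding coeff_mult coeff_add sum.distrib[symmetric]
    by (auto intro!: derivative_eq_intros sum.cong assms[THEN poly_has_derivative_coeff] simp: algebra_simps)
  ultimately show ?thesis
    unfolding poly_has_derivative_def by blast
qed

lemma poly_has_derivative_minus:
  assumes "poly_has_derivative R R'"
  shows "poly_has_derivative (\<lambda>t. - R t) (- R')"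
  using assms unfolding poly_has_derivative_def by (auto intro!: DERIV_minus)

lemma poly_has_derivative_diff:
  assumes "poly_has_derivative R R'" "poly_has_derivative S S'"
  shows "poly_has_derivative (\<lambda>t. R t - S t) (R' - S')"
  using poly_has_derivative_add[OF assms(1) poly_has_derivative_minus[OF assms(2)]] by simp

lemma poly_has_derivative_pderiv:
  assumes "poly_has_derivative R R'"
  shows "poly_has_derivative (\<lambda>t. pderiv (R t)) (pderiv R')"
proof -
  obtain D where "eventually (\<lambda>t. degree (R t) \<le> D) (nhds 0)"
    using assms poly_has_derivative_degree by metis
  hence "eventually (\<lambda>t. degree (pderiv (R t)) \<le> D) (nhds 0)"
    by eventually_elim (simp add: degree_pderiv)
  moreover have "((\<lambda>t. coeff (pderiv (R t)) i) has_field_derivative coeff (pderiv R') i) (at 0)" for i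
    unfolding coeff_pderiv by (intro DERIV_cmult assms[THEN poly_has_derivative_coeff])
  ultimately show ?thesis
    unfolding poly_has_derivative_def by blast
qed

lemma poly_has_derivative_funpow_pderiv:
  assumes "poly_has_derivative R R'"
  shows "poly_has_derivative (\<lambda>t. (pderiv ^^ i) (R t)) ((pderiv ^^ i) R')"
  using assms by (induction i) (auto intro: poly_has_derivative_pderiv)

text \<open>Both polynomials are evaluated at the same moving point, so convergence of
  \<open>a\<close> suffices: the quotient is a sum of coefficient quotients times powers of
  \<open>a t\<close>.\<close>

lemma poly_has_derivative_difference_quotient:
  assumes "poly_has_derivative R R'" "(a \<longlongrightarrow> c) (at 0)"
  shows "((\<lambda>t. (poly (R t) (a t) - poly (R 0) (a t)) / t) \<longlongrightarrow> poly R' c) (at 0)"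
proof -
  obtain D where D: "eventually (\<lambda>t. degree (R t) \<le> D) (nhds 0)"
    using assms poly_has_derivative_degree by metis
  have D0: "degree (R 0) \<le> D" using D eventually_nhds_x_imp_x by blast
  have "((\<lambda>t. \<Sum>i\<le>D. (coeff (R t) i - coeff (R 0) i) / t * a t ^ i) \<longlongrightarrow> (\<Sum>i\<le>D. coeff R' i * c ^ i)) (at 0)"
    by (intro tendsto_intros assms(2))
      (use poly_has_derivative_coeff[OF assms(1)] in \<open>simp add: has_field_derivative_iff\<close>)
  moreover have "eventually (\<lambda>t. degree (R t) \<le> D) (at 0)"
    using D by (simp add: eventually_at_filter eventually_mono)
  hence "eventually (\<lambda>t. (\<Sum>i\<le>D. (coeff (R t) i - coeff (R 0) i) / t * a t ^ i) =
      (poly (R t) (a t) - poly (R 0) (a t)) / t) (at 0)"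
    by eventually_elim
      (simp add: poly_eq_sum_coeff[where D = D] D0 sum_divide_distrib sum_subtractf[symmetric] field_simps)
  ultimately show ?thesis
    using poly_has_derivative_degree_le[OF assms(1) D]
    by (simp add: poly_eq_sum_coeff[where D = D] Lim_transform_eventually)
qed

lemma poly_has_derivative_tendsto:
  assumes "poly_has_derivative R R'" "(a \<longlongrightarrow> c) (at 0)"
  shows "((\<lambda>t. poly (R t) (a t)) \<longlongrightarrow> poly (R 0) c) (at 0)"
proof -
  have "((\<lambda>t. (poly (R t) (a t) - poly (R 0) (a t)) / t * t + poly (R 0) (a t)) \<longlongrightarrow>
      poly R' c * 0 + poly (R 0) c) (at 0)"
    by (intro tendsto_intros poly_has_derivative_difference_quotient assms)
  moreover have "eventually (\<lambda>t. (poly (R t) (a t) - poly (R 0) (a t)) / t * t + poly (R 0) (a t) = poly (R t) (a t)) (at 0)"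
    by (auto simp: eventually_at_filter)
  ultimately show ?thesis
    by (simp add: Lim_transform_eventually)
qed

lemma poly_has_derivative_eval:
  assumes "poly_has_derivative R R'"
  shows "((\<lambda>t. poly (R t) u) has_field_derivative poly R' u) (at 0)"
  using poly_has_derivative_difference_quotient[OF assms tendsto_const, of u]
  by (simp add: has_field_derivative_iff)

text \<open>The value equals that of \<open>R 0 - R t\<close> at \<open>a t\<close>, whose
  coefficients tend to 0 while the powers of \<open>a t\<close> stay bounded. It prepares the proof
  that a moving root converges.\<close>

lemma poly_family_zero_bounded:
  assumes "poly_has_derivative R R'" "eventually (\<lambda>t. norm (a t) \<le> B) (at 0)"
    and "eventually (\<lambda>t. poly (R t) (a t) = 0) (at 0)"
  shows "((\<lambda>t. poly (R 0) (a t)) \<longlongrightarrow> 0) (at 0)"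
proof -
  obtain D where D: "eventually (\<lambda>t. degree (R t) \<le> D) (nhds 0)"
    using assms poly_has_derivative_degree by metis
  have D0: "degree (R 0) \<le> D" using D eventually_nhds_x_imp_x by blast
  have ev: "eventually (\<lambda>t. degree (R t) \<le> D) (at 0)"
    using D by (simp add: eventually_at_filter eventually_mono)
  have "((\<lambda>t. (coeff (R 0) i - coeff (R t) i) * a t ^ i) \<longlongrightarrow> 0) (at 0)" for i
  proof (rule Lim_null_comparison)
    have "(\<lambda>t. coeff (R t) i) \<midarrow>0\<rightarrow> coeff (R 0) i"
      using poly_has_derivative_coeff[OF assms(1), of i] DERIV_isCont isCont_def by blast
    hence "((\<lambda>t. norm (coeff (R 0) i - coeff (R t) i) * B ^ i) \<longlongrightarrow> norm (coeff (R 0) i - coeff (R 0) i) * B ^ i) (at 0)"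
      by (intro tendsto_intros)
    thus "((\<lambda>t. norm (coeff (R 0) i - coeff (R t) i) * B ^ i) \<longlongrightarrow> 0) (at 0)" by simp
    show "eventually (\<lambda>t. norm ((coeff (R 0) i - coeff (R t) i) * a t ^ i) \<le> norm (coeff (R 0) i - coeff (R t) i) * B ^ i) (at 0)"
      using assms(2) by eventually_elim (auto simp: norm_mult norm_power intro!: mult_left_mono power_mono)
  qed
  hence "((\<lambda>t. \<Sum>i\<le>D. (coeff (R 0) i - coeff (R t) i) * a t ^ i) \<longlongrightarrow> 0) (at 0)"
    by (rule tendsto_null_sum)
  moreover have "eventually (\<lambda>t. (\<Sum>i\<le>D. (coeff (R 0) i - coeff (R t) i) * a t ^ i) = poly (R 0) (a t)) (at 0)"
    using ev assms(3)
  proof eventually_elim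
    case (elim t)
    have "(\<Sum>i\<le>D. (coeff (R 0) i - coeff (R t) i) * a t ^ i) = poly (R 0) (a t) - poly (R t) (a t)"
      using elim(1) D0 by (simp add: poly_eq_sum_coeff[where D = D] algebra_simps sum_subtractf)
    with elim show ?case by simp
  qed
  ultimately show ?thesis by (rule Lim_transform_eventually)
qed

text \<open>Expanding \<open>R\<^sub>t\<^sup>(\<^sup>i\<^sup>)(a t) = 0\<close> to first order in \<open>t\<close>: the case \<open>i = m\<close> shows that \<open>a t - c\<close> is \<open>O(t)\<close>,
  and then the terms of \<open>R\<^sub>0\<close> are \<open>O(t\<^sup>2)\<close> for \<open>i < m\<close>. So the moving root need not be known to
  be differentiable.\<close>

lemma poly_family_multiple_root:
  assumes R: "poly_has_derivative R R'" and a: "(a \<longlongrightarrow> c) (at 0)"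
    and dvd: "eventually (\<lambda>t. [:- a t, 1:] ^ Suc m dvd R t) (at 0)"
    and R0: "R 0 \<noteq> 0" "order c (R 0) = Suc m"
  shows "[:-c, 1:] ^ m dvd R'"
proof -
  obtain S where S: "R 0 = [:-c, 1:] ^ Suc m * S" "\<not> [:-c, 1:] dvd S"
    using order_decomp[OF R0(1), of c] R0(2) by auto
  have S0: "poly S c \<noteq> 0" using S(2) by (simp add: poly_eq_0_iff_dvd)
  \<comment> \<open>The derivatives of \<open>R t\<close> up to order \<open>m\<close> vanish at
    \<open>a t\<close>, so only the \<open>R 0\<close> part of the difference quotient
    survives.\<close>
  have lim: "((\<lambda>t. poly ((pderiv ^^ i) (R 0)) (a t) / t) \<longlongrightarrow> - poly ((pderiv ^^ i) R') c) (at 0)" if "i \<le> m" for i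
  proof -
    have "((\<lambda>t. - ((poly ((pderiv ^^ i) (R t)) (a t) - poly ((pderiv ^^ i) (R 0)) (a t)) / t)) \<longlongrightarrow> - poly ((pderiv ^^ i) R') c) (at 0)"
      by (intro tendsto_minus poly_has_derivative_difference_quotient poly_has_derivative_funpow_pderiv R a)
    moreover have "eventually (\<lambda>t. - ((poly ((pderiv ^^ i) (R t)) (a t) - poly ((pderiv ^^ i) (R 0)) (a t)) / t) =
        poly ((pderiv ^^ i) (R 0)) (a t) / t) (at 0)"
      using dvd
    proof eventually_elim
      case (elim t)
      from pderiv_funpow_vanish[OF this, of i] that show ?case by simp
    qed
    ultimately show ?thesis by (rule Lim_transform_eventually)
  qed
  \<comment> \<open>At order \<open>m\<close> the zero at \<open>c\<close> is simple; dividing by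
    the cofactor \<open>T\<close> yields the velocity \<open>L\<close> of the root.\<close>
  obtain T where T: "(pderiv ^^ m) (R 0) = [:-c, 1:] ^ (Suc m - m) * T" "poly T c \<noteq> 0"
    using pderiv_funpow_root_power[OF S0, of m "Suc m"] S(1) by auto
  have Tlim: "((\<lambda>t. poly T (a t)) \<longlongrightarrow> poly T c) (at 0)"
    by (intro tendsto_intros a)
  define L where "L = - poly ((pderiv ^^ m) R') c / poly T c"
  have "((\<lambda>t. poly ((pderiv ^^ m) (R 0)) (a t) / t / poly T (a t)) \<longlongrightarrow> L) (at 0)"
    unfolding L_def by (intro tendsto_divide lim Tlim T(2)) simp
  moreover have "eventually (\<lambda>t. poly T (a t) \<noteq> 0) (at 0)"
    using tendsto_imp_eventually_ne[OF Tlim T(2)] .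
  hence "eventually (\<lambda>t. poly ((pderiv ^^ m) (R 0)) (a t) / t / poly T (a t) = (a t - c) / t) (at 0)"
    by eventually_elim (simp add: T(1) left_diff_distrib[symmetric])
  ultimately have L: "((\<lambda>t. (a t - c) / t) \<longlongrightarrow> L) (at 0)"
    by (rule Lim_transform_eventually)
  show ?thesis
  proof (rule power_dvd_if_pderiv_vanish)
    fix i assume i: "i < m"
    obtain U where U: "(pderiv ^^ i) (R 0) = [:-c, 1:] ^ (Suc m - i) * U"
      using pderiv_funpow_root_power[OF S0, of i "Suc m"] S(1) i by auto
    \<comment> \<open>One factor \<open>a t - c\<close> absorbs the division by \<open>t\<close>;
      the remaining \<open>m - i > 0\<close> factors tend to 0.\<close>
    have "((\<lambda>t. (a t - c) / t * ((a t - c) ^ (m - i) * poly U (a t))) \<longlongrightarrow> L * ((c - c) ^ (m - i) * poly U c)) (at 0)"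
      by (intro tendsto_intros L a)
    moreover have "(a t - c) / t * ((a t - c) ^ (m - i) * poly U (a t)) = poly ((pderiv ^^ i) (R 0)) (a t) / t" for t
      using i by (simp add: U Suc_diff_le left_diff_distrib)
    ultimately have "((\<lambda>t. poly ((pderiv ^^ i) (R 0)) (a t) / t) \<longlongrightarrow> 0) (at 0)"
      using i by (simp only: cancel_comm_monoid_add_class.diff_cancel power_0_left) simp
    with lim[of i] i have "- poly ((pderiv ^^ i) R') c = 0"
      by (intro tendsto_unique[OF _ lim]) auto
    thus "poly ((pderiv ^^ i) R') c = 0" by simp
  qed
qed

lemma poly_has_derivative_exists:
  assumes "\<And>i. \<exists>e. ((\<lambda>t. coeff (R t) i) has_field_derivative e) (at 0)"
    and D: "eventually (\<lambda>t. degree (R t) \<le> D) (nhds 0)"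
  shows "\<exists>R'. poly_has_derivative R R'"
proof -
  obtain e where e: "((\<lambda>t. coeff (R t) i) has_field_derivative e i) (at 0)" for i
    using assms(1) by metis
  define R' where "R' = (\<Sum>i\<le>D. monom (e i) i)"
  have "((\<lambda>t. coeff (R t) i) has_field_derivative coeff R' i) (at 0)" for i
  proof (cases "i \<le> D")
    case True
    thus ?thesis using e[of i] by (simp add: R'_def coeff_sum if_distrib sum.delta' cong: if_cong)
  next
    case False
    have "eventually (\<lambda>t. coeff (R t) i = 0) (nhds 0)"
      using D by eventually_elim (use False in \<open>auto intro: coeff_eq_0\<close>)
    hence "((\<lambda>t. coeff (R t) i) has_field_derivative 0) (at 0)"
      by (rule has_field_derivative_eventually_const)
    moreover have "coeff R' i = 0" using False by (auto simp: R'_def coeff_sum intro!: sum.neutral)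
    ultimately show ?thesis by simp
  qed
  with D show ?thesis unfolding poly_has_derivative_def by blast
qed

text \<open>Chain rule along the complex line in direction \<open>k\<close>: the complex linear
  derivative restricts to multiplication by \<open>\<gamma> k\<close>, hence is a complex
  derivative.\<close>

lemma mv_holomorphic_partial_derivative:
  assumes "mv_holomorphic_on h U" "u \<in> U"
  shows "\<exists>D. ((\<lambda>t. h (u + (0, 0, axis k t))) has_field_derivative D) (at 0)"
proof -
  obtain \<alpha> \<beta> \<gamma> where h: "(h has_derivative (\<lambda>(s, b, v). \<alpha> * s + \<beta> * b + (\<Sum>j\<in>UNIV. \<gamma> j * v $ j))) (at u)"
    using assms unfolding mv_holomorphic_on_def by blast
  have "linear (axis k :: complex \<Rightarrow> _)"
    by (rule linearI) (auto simp: vec_eq_iff axis_def)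
  hence "bounded_linear (axis k :: complex \<Rightarrow> _)"
    by (simp add: linear_conv_bounded_linear)
  hence "((\<lambda>t. u + (0, 0, axis k t)) has_derivative (\<lambda>t. (0, 0, axis k t))) (at 0)"
    by (auto intro!: derivative_eq_intros bounded_linear_imp_has_derivative)
  moreover have "u + (0, 0, axis k 0) = u" by (simp add: zero_prod_def[symmetric] axis_def vec_eq_iff prod_eq_iff)
  ultimately have "((\<lambda>t. h (u + (0, 0, axis k t))) has_derivative
      (\<lambda>t. (\<lambda>(s, b, v). \<alpha> * s + \<beta> * b + (\<Sum>j\<in>UNIV. \<gamma> j * v $ j)) (0, 0, axis k t))) (at 0)"
    using h by (intro has_derivative_compose[of "\<lambda>t. u + (0, 0, axis k t)" _ 0 UNIV h]) auto
  moreover have "(\<Sum>j\<in>UNIV. \<gamma> j * axis k t $ j) = \<gamma> k * t" for t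
    by (simp add: axis_def if_distrib cong: if_cong)
  ultimately show ?thesis
    unfolding has_field_derivative_def by (auto intro!: exI[of _ "\<gamma> k"])
qed

subsection \<open>Rational maps and their iterates\<close>

text \<open>The map \<open>g\<close> is \<open>rtop g / rden g\<close> in lowest terms, and its derivative is \<open>rwron g / (rden g)\<^sup>2\<close>. At every
  point, poles included, the order of \<open>rwron g\<close> is the multiplicity as a critical point.\<close>

definition rtop :: "ratmap \<Rightarrow> complex poly" where
  "rtop g = [:rconst g, rsigma g:] * rden g + rnum g"

definition rwron :: "ratmap \<Rightarrow> complex poly" where
  "rwron g = pderiv (rtop g) * rden g - rtop g * pderiv (rden g)"

lemma rmap_Some_nonpole:
  "poly (rden g) z \<noteq> 0 \<Longrightarrow> rmap g (Some z) = Some (poly (rtop g) z / poly (rden g) z)"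
  by (simp add: rtop_def field_simps)

lemma aff_rmap: "poly (rden g) z \<noteq> 0 \<Longrightarrow> aff (rmap g) z = poly (rtop g) z / poly (rden g) z"
  by (simp add: aff_def rmap_Some_nonpole del: rmap.simps)

lemma recip_rmap: "poly (rtop g) z \<noteq> 0 \<Longrightarrow> recip (rmap g (Some z)) = poly (rden g) z / poly (rtop g) z"
  by (cases "poly (rden g) z = 0") (simp, simp add: rmap_Some_nonpole del: rmap.simps)

lemma rnum_nonzero_at_pole:
  assumes "normal_form d g" "poly (rden g) z = 0"
  shows "poly (rnum g) z \<noteq> 0"
proof
  assume "poly (rnum g) z = 0"
  hence "[:-z, 1:] dvd 1"
    using assms unfolding normal_form_def poly_eq_0_iff_dvd by (metis coprime_common_divisor)
  thus False by (simp add: is_unit_pCons_iff)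
qed

lemma rtop_nonzero_at_pole:
  assumes "normal_form d g" "poly (rden g) z = 0"
  shows "poly (rtop g) z \<noteq> 0"
  using rnum_nonzero_at_pole[OF assms] assms by (simp add: rtop_def)

section \<open>Critical points and their multiplicities in terms of polynomials\<close>

lemma has_field_derivative_aff_rmap:
  assumes "poly (rden g) z \<noteq> 0"
  shows "(aff (rmap g) has_field_derivative poly (rwron g) z / (poly (rden g) z)\<^sup>2) (at z)"
proof (rule has_field_derivative_transform_within_open)
  show "((\<lambda>w. poly (rtop g) w / poly (rden g) w) has_field_derivative poly (rwron g) z / (poly (rden g) z)\<^sup>2) (at z)"
    using assms by (auto intro!: derivative_eq_intros simp: rwron_def power2_eq_square)
  show "open {w. poly (rden g) w \<noteq> 0}" by (intro open_Collect_neq continuous_intros)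
qed (use assms in \<open>auto simp: aff_rmap\<close>)

text \<open>Exchanging numerator and denominator changes the sign of the Wronskian.\<close>

lemma has_field_derivative_recip_rmap:
  assumes "poly (rtop g) z \<noteq> 0"
  shows "((\<lambda>w. recip (rmap g (Some w))) has_field_derivative - poly (rwron g) z / (poly (rtop g) z)\<^sup>2) (at z)"
proof (rule has_field_derivative_transform_within_open)
  show "((\<lambda>w. poly (rden g) w / poly (rtop g) w) has_field_derivative - poly (rwron g) z / (poly (rtop g) z)\<^sup>2) (at z)"
    using assms by (auto intro!: derivative_eq_intros simp: rwron_def power2_eq_square algebra_simps)
  show "open {w. poly (rtop g) w \<noteq> 0}" by (intro open_Collect_neq continuous_intros)
qed (use assms in \<open>auto simp: recip_rmap simp del: rmap.simps\<close>)

text \<open>\<open>B\<close> is the denominator in the chart chosen at \<open>z\<close>: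
  \<open>rtop g\<close> with \<open>e = -1\<close> at a pole, \<open>rden g\<close> with
  \<open>e = 1\<close> elsewhere. The chart stays fixed while \<open>w\<close> varies, as orders of
  zeros require.\<close>

lemma deriv_chart_rep:
  assumes "normal_form d g"
  obtains B e where "poly B z \<noteq> 0" "e \<noteq> 0"
    "\<And>w. poly B w \<noteq> 0 \<Longrightarrow> deriv (chart_rep (rmap g) z) w = e * poly (rwron g) w / (poly B w)\<^sup>2"
proof (cases "poly (rden g) z = 0")
  case True
  hence "chart_rep (rmap g) z = (\<lambda>w. recip (rmap g (Some w)))"
    by (simp add: chart_rep_def)
  with that[of "rtop g" "-1"] show ?thesis
    using rtop_nonzero_at_pole[OF assms True] has_field_derivative_recip_rmap[of g]
    by (metis DERIV_imp_deriv mult_minus1 neg_0_equal_iff_equal zero_neq_one)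
next
  case False
  hence "chart_rep (rmap g) z = aff (rmap g)" by (simp add: chart_rep_def)
  with that[of "rden g" 1] False show ?thesis
    using has_field_derivative_aff_rmap[of g] by (metis DERIV_imp_deriv mult_1 zero_neq_one)
qed

lemma crit_point_rmap_iff:
  assumes "normal_form d g"
  shows "crit_point (rmap g) z \<longleftrightarrow> poly (rwron g) z = 0"
proof -
  obtain B e where "poly B z \<noteq> 0" "e \<noteq> 0"
    "\<And>w. poly B w \<noteq> 0 \<Longrightarrow> deriv (chart_rep (rmap g) z) w = e * poly (rwron g) w / (poly B w)\<^sup>2"
    using deriv_chart_rep[OF assms] by metis
  thus ?thesis by (simp add: crit_point_def)
qed

lemma crit_mult_rmap:
  assumes "normal_form d g" "rwron g \<noteq> 0"
  shows "crit_mult (rmap g) z = int (order z (rwron g))"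
proof -
  obtain B e where B: "poly B z \<noteq> 0" "e \<noteq> 0"
    "\<And>w. poly B w \<noteq> 0 \<Longrightarrow> deriv (chart_rep (rmap g) z) w = e * poly (rwron g) w / (poly B w)\<^sup>2"
    using deriv_chart_rep[OF assms(1)] by metis
  obtain S where S: "rwron g = [:-z, 1:] ^ order z (rwron g) * S" "\<not> [:-z, 1:] dvd S"
    using order_decomp[OF assms(2)] by blast
  have S0: "poly S z \<noteq> 0" using S(2) by (simp add: poly_eq_0_iff_dvd)
  show ?thesis unfolding crit_mult_def
  proof (rule zorder_eqI)
    show "open {w. poly B w \<noteq> 0}" by (intro open_Collect_neq continuous_intros)
    show "(\<lambda>w. e * poly S w / (poly B w)\<^sup>2) holomorphic_on {w. poly B w \<noteq> 0}"
      by (intro holomorphic_intros) auto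
    fix w assume w: "w \<in> {w. poly B w \<noteq> 0}"
    have "poly (rwron g) w = (w - z) ^ order z (rwron g) * poly S w"
      by (subst S(1)) simp
    thus "deriv (chart_rep (rmap g) z) w = e * poly S w / (poly B w)\<^sup>2 * (w - z) powi int (order z (rwron g))"
      using w by (simp add: B(3))
  qed (use B S0 in auto)
qed

lemma degree_rtop_minus:
  assumes "d \<ge> 2" "normal_form d g"
  shows "degree (rtop g - smult x (rden g)) = d"
proof -
  have nf: "rsigma g \<noteq> 0" "lead_coeff (rden g) = 1" "degree (rden g) = d - 1" "degree (rnum g) \<le> d - 2"
    using assms by (auto simp: normal_form_def)
  have "degree ([:rconst g, rsigma g:] * rden g) = d"
    using nf assms(1) by (subst degree_mult_eq) auto
  moreover have "degree (rnum g - smult x (rden g)) < d"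
    using nf assms(1) by (intro degree_diff_less) auto
  moreover have "rtop g - smult x (rden g) = [:rconst g, rsigma g:] * rden g + (rnum g - smult x (rden g))"
    by (simp add: rtop_def)
  ultimately show ?thesis by (simp only: degree_add_eq_left)
qed

text \<open>\<open>W = \<sigma> Q^2 + (P' Q - P Q')\<close>, where the bracket has smaller degree.
  Counted with multiplicity, all \<open>2 * d - 2\<close> critical points are thus finite.\<close>

lemma degree_rwron:
  assumes "d \<ge> 2" "normal_form d g"
  shows "degree (rwron g) = 2 * d - 2"
proof -
  have nf: "rsigma g \<noteq> 0" "lead_coeff (rden g) = 1" "degree (rden g) = d - 1" "degree (rnum g) \<le> d - 2"
    using assms by (auto simp: normal_form_def)
  hence Q: "rden g \<noteq> 0" by auto
  have eq: "rwron g = smult (rsigma g) (rden g * rden g) + (pderiv (rnum g) * rden g - rnum g * pderiv (rden g))"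
    unfolding rwron_def rtop_def
    by (simp add: pderiv_mult pderiv_add pderiv_pCons pderiv_smult algebra_simps)
  have "degree (pderiv (rnum g) * rden g) < 2 * d - 2"
    using degree_mult_le[of "pderiv (rnum g)" "rden g"] nf assms(1)
    by (cases "pderiv (rnum g) = 0") (simp, auto simp: degree_pderiv pderiv_eq_0_iff)
  moreover have "degree (rnum g * pderiv (rden g)) < 2 * d - 2"
    using degree_mult_le[of "rnum g" "pderiv (rden g)"] nf assms(1) by (simp add: degree_pderiv)
  moreover have "degree (smult (rsigma g) (rden g * rden g)) = 2 * d - 2"
    using nf Q assms(1) by (simp add: degree_mult_eq)
  ultimately show ?thesis
    unfolding eq by (metis degree_add_eq_left degree_diff_less)
qed

lemma rwron_nonzero:
  assumes "d \<ge> 2" "normal_form d g"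
  shows "rwron g \<noteq> 0"
  using degree_rwron[OF assms] assms(1) by auto

lemma order_rden_at_pole:
  assumes "d \<ge> 2" "normal_form d g" "poly (rden g) z = 0"
  shows "order z (rden g) = Suc (order z (rwron g))"
proof -
  have "rden g \<noteq> 0" using assms by (auto simp: normal_form_def)
  from order_wronskian[OF this assms(3) rtop_nonzero_at_pole[OF assms(2,3)]]
  have "order z (rden g) = Suc (order z (- rwron g))"
    by (simp add: rwron_def algebra_simps)
  thus ?thesis by simp
qed

text \<open>Subtracting \<open>v\<close> times the denominator from the numerator leaves the
  Wronskian unchanged, so \<open>order_wronskian\<close> applies to the difference.\<close>

lemma order_rtop_minus:
  assumes "d \<ge> 2" "normal_form d g" "poly (rden g) z \<noteq> 0" "poly (rtop g) z = v * poly (rden g) z"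
  shows "order z (rtop g - smult v (rden g)) = Suc (order z (rwron g))"
proof -
  have "rtop g - smult v (rden g) \<noteq> 0" using degree_rtop_minus[OF assms(1,2), of v] assms(1) by auto
  from order_wronskian[OF this _ assms(3)] assms(4) show ?thesis
    by (simp add: rwron_def algebra_simps pderiv_diff pderiv_smult)
qed

section \<open>Iterates and the escape time\<close>

lemma rmap_funpow_None: "(rmap f ^^ n) None = None"
  by (induction n) auto

text \<open>Infinity is fixed, so an orbit never returns from it.\<close>

lemma less_escape_time_iff: "enat n < escape_time f z \<longleftrightarrow> (rmap f ^^ n) (Some z) \<noteq> None"
proof
  assume l: "enat n < escape_time f z"
  show "(rmap f ^^ n) (Some z) \<noteq> None"
  proof
    assume n: "(rmap f ^^ n) (Some z) = None"
    hence "(LEAST l. (rmap f ^^ l) (Some z) = None) \<le> n" by (rule Least_le)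
    moreover from n have "escape_time f z = enat (LEAST l. (rmap f ^^ l) (Some z) = None)"
      unfolding escape_time_def by metis
    ultimately show False using l by simp
  qed
next
  assume n: "(rmap f ^^ n) (Some z) \<noteq> None"
  have "n < l" if "(rmap f ^^ l) (Some z) = None" for l
  proof (rule ccontr)
    assume "\<not> n < l"
    then obtain k where "n = k + l" by (metis le_add_diff_inverse2 linorder_not_less)
    with that n show False by (simp add: funpow_add rmap_funpow_None)
  qed
  thus "enat n < escape_time f z"
    unfolding escape_time_def by (auto dest: LeastI[where P = "\<lambda>l. (rmap f ^^ l) (Some z) = None"])
qed

lemma Suc_eq_escape_time_iff:
  "enat (Suc n) = escape_time f z \<longleftrightarrow> enat n < escape_time f z \<and> \<not> enat (Suc n) < escape_time f z"
  by (metis Suc_ile_eq order.order_iff_strict order.strict_iff_not)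

lemma rmap_funpow_Some: "enat n < escape_time f z \<Longrightarrow> (rmap f ^^ n) (Some z) = Some (iter f n z)"
  by (auto simp: less_escape_time_iff iter_def aff_def)

lemma rden_iter_nonzero_iff:
  assumes "enat n < escape_time f z"
  shows "poly (rden f) (iter f n z) \<noteq> 0 \<longleftrightarrow> enat (Suc n) < escape_time f z"
  using rmap_funpow_Some[OF assms] by (simp add: less_escape_time_iff)

lemma iter_Suc:
  assumes "enat n < escape_time f z"
  shows "iter f (Suc n) z = aff (rmap f) (iter f n z)"
  using rmap_funpow_Some[OF assms] by (simp add: iter_def aff_def)

text \<open>The two claims are proved together: differentiability gives continuity, so nearby orbits
  also avoid the poles at the next step. The recursion \<open>iter_Suc\<close> is only available
  before escape, hence must be secured on a neighbourhood.\<close>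

lemma iter_local:
  assumes "enat n < escape_time f z"
  shows "eventually (\<lambda>w. enat n < escape_time f w) (nhds z) \<and> iter f n field_differentiable at z"
  using assms
proof (induction n)
  case 0
  have "iter f 0 = (\<lambda>w. w)" by (auto simp: iter_def aff_def)
  thus ?case by (simp add: less_escape_time_iff)
next
  case (Suc n)
  hence n: "enat n < escape_time f z" by (metis Suc_ile_eq order.strict_implies_order)
  from Suc.IH[OF n] have ev: "eventually (\<lambda>w. enat n < escape_time f w) (nhds z)"
    and d: "iter f n field_differentiable at z" by auto
  have Q: "poly (rden f) (iter f n z) \<noteq> 0" using rden_iter_nonzero_iff[OF n] Suc.prems by simp
  have "isCont (\<lambda>w. poly (rden f) (iter f n w)) z"
    using field_differentiable_imp_continuous_at[OF d] by (intro continuous_intros)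
  from tendsto_imp_eventually_ne[OF isContD[OF this] Q]
  have "eventually (\<lambda>w. poly (rden f) (iter f n w) \<noteq> 0) (nhds z)"
    using Q by (simp add: eventually_nhds_conv_at)
  with ev have "eventually (\<lambda>w. enat (Suc n) < escape_time f w) (nhds z)"
    by eventually_elim (simp add: rden_iter_nonzero_iff)
  moreover have "((\<lambda>w. aff (rmap f) (iter f n w)) has_field_derivative
      poly (rwron f) (iter f n z) / (poly (rden f) (iter f n z))\<^sup>2 * deriv (iter f n) z) (at z)"
    by (rule DERIV_chain2[where g = "iter f n", OF has_field_derivative_aff_rmap[OF Q]])
      (use d in \<open>simp add: field_differentiable_derivI\<close>)
  moreover have "eventually (\<lambda>w. iter f (Suc n) w = aff (rmap f) (iter f n w)) (nhds z)"
    using ev by eventually_elim (rule iter_Suc)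
  ultimately show ?case
    unfolding field_differentiable_def by (metis DERIV_cong_ev)
qed

lemma deriv_iter_Suc:
  assumes "enat (Suc n) < escape_time f z"
  shows "deriv (iter f (Suc n)) z =
    poly (rwron f) (iter f n z) / (poly (rden f) (iter f n z))\<^sup>2 * deriv (iter f n) z"
proof -
  have n: "enat n < escape_time f z" using assms by (metis Suc_ile_eq order.strict_implies_order)
  have Q: "poly (rden f) (iter f n z) \<noteq> 0" using rden_iter_nonzero_iff[OF n] assms by simp
  have "((\<lambda>w. aff (rmap f) (iter f n w)) has_field_derivative
      poly (rwron f) (iter f n z) / (poly (rden f) (iter f n z))\<^sup>2 * deriv (iter f n) z) (at z)"
    by (rule DERIV_chain2[where g = "iter f n", OF has_field_derivative_aff_rmap[OF Q]])
      (use iter_local[OF n] in \<open>simp add: field_differentiable_derivI\<close>)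
  moreover have "eventually (\<lambda>w. iter f (Suc n) w = aff (rmap f) (iter f n w)) (nhds z)"
    using iter_local[OF n, THEN conjunct1] by eventually_elim (rule iter_Suc)
  ultimately show ?thesis
    by (metis DERIV_cong_ev DERIV_imp_deriv)
qed

lemma deriv_iter_nonzero:
  assumes "enat n < escape_time f z" "\<not> crit_point (rmap f ^^ n) z"
  shows "deriv (iter f n) z \<noteq> 0"
  using assms rmap_funpow_Some[OF assms(1)]
  by (simp add: crit_point_def chart_rep_def iter_def)

text \<open>Chain rule for the next iterate. If \<open>iter f n z\<close> is a pole, it is applied
  in the chart at infinity, which covers the last step before escape.\<close>

lemma rwron_iter_nonzero:
  assumes f: "normal_form d f" and n: "enat n < escape_time f z"
    and crit: "\<not> crit_point (rmap f ^^ Suc n) z"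
  shows "poly (rwron f) (iter f n z) \<noteq> 0"
proof (cases "enat (Suc n) < escape_time f z")
  case True
  thus ?thesis using deriv_iter_nonzero[OF True crit] deriv_iter_Suc[OF True] by auto
next
  case False
  hence Q: "poly (rden f) (iter f n z) = 0" using rden_iter_nonzero_iff[OF n] by simp
  have "((\<lambda>w. recip (rmap f (Some (iter f n w)))) has_field_derivative
      - poly (rwron f) (iter f n z) / (poly (rtop f) (iter f n z))\<^sup>2 * deriv (iter f n) z) (at z)"
    by (rule DERIV_chain2[where g = "iter f n", OF has_field_derivative_recip_rmap[OF rtop_nonzero_at_pole[OF f Q]]])
      (use iter_local[OF n] in \<open>simp add: field_differentiable_derivI\<close>)
  moreover have "eventually (\<lambda>w. chart_rep (rmap f ^^ Suc n) z w = recip (rmap f (Some (iter f n w)))) (nhds z)"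
    using iter_local[OF n, THEN conjunct1]
  proof eventually_elim
    case (elim w)
    have "chart_rep (rmap f ^^ Suc n) z = (\<lambda>w. recip ((rmap f ^^ Suc n) (Some w)))"
      using False by (simp add: chart_rep_def less_escape_time_iff del: funpow.simps)
    thus ?case using rmap_funpow_Some[OF elim] by simp
  qed
  ultimately have "deriv (chart_rep (rmap f ^^ Suc n) z) z =
      - poly (rwron f) (iter f n z) / (poly (rtop f) (iter f n z))\<^sup>2 * deriv (iter f n) z"
    by (metis DERIV_cong_ev DERIV_imp_deriv)
  with crit show ?thesis by (auto simp: crit_point_def)
qed

subsection \<open>The derivative with respect to a critical value\<close>

text \<open>Both enumerations have the same range, so \<open>a j = a' i\<close> for some
  \<open>i\<close>; this point lies in the discs about \<open>c j\<close> and \<open>c i\<close>,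
  which forces \<open>i = j\<close>.\<close>

lemma marking_unique:
  assumes disj: "\<forall>i j. i \<noteq> j \<longrightarrow> ball (c i) \<epsilon> \<inter> ball (c j) \<epsilon> = {}"
    and a: "is_marking f c \<epsilon> g a" and a': "is_marking f c \<epsilon> g a'"
  shows "a = a'"
proof
  fix j
  have "a j \<in> range a'" using a a' unfolding is_marking_def by (metis rangeI)
  then obtain i where i: "a j = a' i" by auto
  have "a j \<in> ball (c j) \<epsilon>" "a' i \<in> ball (c i) \<epsilon>"
    using a a' by (auto simp: is_marking_def dist_commute)
  with i disj have "i = j" by (metis disjoint_iff)
  with i show "a j = a' j" by simp
qed

lemma is_marking_marking:
  assumes "local_coordinate d f c \<epsilon>" "g \<in> Lambda d f c \<epsilon>"
  shows "is_marking f c \<epsilon> g (marking f c \<epsilon> g)"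
proof -
  obtain a where a: "is_marking f c \<epsilon> g a" using assms by (auto simp: Lambda_def)
  show ?thesis unfolding marking_def
  proof (rule theI[of "is_marking f c \<epsilon> g" a, OF a])
    fix b assume "is_marking f c \<epsilon> g b"
    thus "b = a" using assms(1) a marking_unique unfolding local_coordinate_def by blast
  qed
qed

lemma self_in_Lambda:
  assumes "normal_form d f" "inj c" "range c = {w. crit_point (rmap f) w}" "\<epsilon> > 0"
  shows "f \<in> Lambda d f c \<epsilon>" "is_marking f c \<epsilon> f c"
proof -
  show m: "is_marking f c \<epsilon> f c" using assms by (simp add: is_marking_def)
  thus "f \<in> Lambda d f c \<epsilon>" using assms by (auto simp: Lambda_def)
qed

text \<open>The orders add up to the degree \<open>2 * d - 2\<close> of \<open>rwron f\<close>, so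
  the degree bound and the divisibilities determine \<open>H\<close>: they say that
  \<open>H / rwron f\<close> is the principal part of \<open>1 / f'\<close> at
  \<open>c k\<close>.\<close>

lemma dfdv_rational:
  fixes c :: "'n::finite \<Rightarrow> complex"
  assumes d: "d \<ge> 2" and f: "normal_form d f"
    and c: "inj c" "range c = {w. crit_point (rmap f) w}"
    and lc: "local_coordinate d f c \<epsilon>"
    and k: "rmap f (Some (c k)) \<noteq> None"
  shows "\<exists>H. degree H \<le> 2 * d - 3 \<and>
    (\<forall>u. poly (rden f) u \<noteq> 0 \<longrightarrow> dfdv d f c \<epsilon> k u = poly H u / (poly (rden f) u)\<^sup>2) \<and>
    (\<forall>j. [:- c j, 1:] ^ order (c j) (rwron f) dvd H - (if j = k then (rden f)\<^sup>2 else 0))"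
proof -
  define U where "U = vbar f c \<epsilon> ` Lambda d f c \<epsilon>"
  define u0 where "u0 = vbar f c \<epsilon> f"
  \<comment> \<open>The path through \<open>f\<close> along which only the coordinate of index
    \<open>k\<close> moves. It is meaningful only while the argument lies in
    \<open>U\<close>.\<close>
  define g where "g t = vbar_inv d f c \<epsilon> (u0 + (0, 0, axis k t))" for t
  define a where "a t = marking f c \<epsilon> (g t)" for t
  have eps: "\<epsilon> > 0" and disj: "\<forall>i j. i \<noteq> j \<longrightarrow> ball (c i) \<epsilon> \<inter> ball (c j) \<epsilon> = {}"
    and inj: "inj_on (vbar f c \<epsilon>) (Lambda d f c \<epsilon>)" and U: "open U"
    using lc by (auto simp: local_coordinate_def U_def)
  note fL = self_in_Lambda[OF f c eps]
  have u0: "u0 \<in> U" using fL by (auto simp: u0_def U_def)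
  have axis0: "u0 + (0, 0, axis k 0) = u0"
    by (simp add: axis_def vec_eq_iff prod_eq_iff)
  have g0: "g 0 = f"
    unfolding g_def axis0 unfolding u0_def vbar_inv_def using inj fL(1) by simp
  have marking_f: "marking f c \<epsilon> f = c"
    using is_marking_marking[OF lc fL(1)] marking_unique[OF disj _ fL(2)] by blast
  have "((\<lambda>t. u0 + (0, 0, axis k t)) \<longlongrightarrow> u0 + (0, 0, axis k 0)) (nhds 0)"
  proof (intro tendsto_intros)
    have "((\<lambda>t. axis k t $ i) \<longlongrightarrow> axis k (0::complex) $ i) (nhds 0)" for i
      by (cases "i = k") (auto simp: axis_def filterlim_ident)
    thus "((\<lambda>t. axis k t) \<longlongrightarrow> axis k (0::complex)) (nhds 0)"
      by (rule vec_tendstoI)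
  qed
  from topological_tendstoD[OF this U] u0
  have evU: "eventually (\<lambda>t. u0 + (0, 0, axis k t) \<in> U) (nhds 0)"
    unfolding axis0 by simp
  have gL: "g t \<in> Lambda d f c \<epsilon>" "vbar f c \<epsilon> (g t) = u0 + (0, 0, axis k t)"
    if "u0 + (0, 0, axis k t) \<in> U" for t
    using that inv_into_into[of _ "vbar f c \<epsilon>"] f_inv_into_f[of _ "vbar f c \<epsilon>"]
    unfolding g_def vbar_inv_def U_def by blast+
  have gnf: "normal_form d (g t)" if "u0 + (0, 0, axis k t) \<in> U" for t
    using gL(1)[OF that] by (simp add: Lambda_def)
  have gsb: "rsigma (g t) = rsigma f" "rconst (g t) = rconst f" if "u0 + (0, 0, axis k t) \<in> U" for t
    using gL(2)[OF that] by (auto simp: vbar_def u0_def)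
  have mark: "is_marking f c \<epsilon> (g t) (a t)" if "u0 + (0, 0, axis k t) \<in> U" for t
    unfolding a_def using is_marking_marking[OF lc] gL[OF that] by simp

  have "\<exists>P'. poly_has_derivative (\<lambda>t. rnum (g t)) P'"
  proof (rule poly_has_derivative_exists)
    show "\<exists>e. ((\<lambda>t. coeff (rnum (g t)) i) has_field_derivative e) (at 0)" for i
      using lc u0 unfolding local_coordinate_def g_def U_def
      by (intro mv_holomorphic_partial_derivative) auto
    show P: "eventually (\<lambda>t. degree (rnum (g t)) \<le> d - 2) (nhds 0)"
      using evU by eventually_elim (use gnf in \<open>auto simp: normal_form_def\<close>)
  qed
  then obtain P' where P': "poly_has_derivative (\<lambda>t. rnum (g t)) P'" by blast
  have "\<exists>Q'. poly_has_derivative (\<lambda>t. rden (g t)) Q'"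
  proof (rule poly_has_derivative_exists)
    show "\<exists>e. ((\<lambda>t. coeff (rden (g t)) i) has_field_derivative e) (at 0)" for i
      using lc u0 unfolding local_coordinate_def g_def U_def
      by (intro mv_holomorphic_partial_derivative) auto
    show "eventually (\<lambda>t. degree (rden (g t)) \<le> d - 1) (nhds 0)"
      using evU by eventually_elim (use gnf in \<open>auto simp: normal_form_def\<close>)
  qed
  then obtain Q' where Q': "poly_has_derivative (\<lambda>t. rden (g t)) Q'" by blast
  have degP: "degree P' \<le> d - 2"
    by (rule poly_has_derivative_degree_le[OF P'])
      (use evU in \<open>eventually_elim, use gnf in \<open>auto simp: normal_form_def\<close>\<close>)
  \<comment> \<open>The denominators are monic, so the coefficient of index \<open>d - 1\<close> is
    constant and drops out. The bound \<open>2 * d - 3\<close> for \<open>H\<close> depends on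
    this.\<close>
  have degQ: "degree Q' \<le> d - 2"
  proof (rule degree_le, intro allI impI)
    fix i assume i: "d - 2 < i"
    have "eventually (\<lambda>t. coeff (rden (g t)) i = (if i = d - 1 then 1 else 0)) (nhds 0)"
      using evU
    proof eventually_elim
      case (elim t)
      from gnf[OF elim] i show ?case by (auto simp: normal_form_def intro: coeff_eq_0)
    qed
    hence "((\<lambda>t. coeff (rden (g t)) i) has_field_derivative 0) (at 0)"
      by (rule has_field_derivative_eventually_const)
    with poly_has_derivative_coeff[OF Q', of i] show "coeff Q' i = 0"
      using DERIV_unique by blast
  qed

  define L where "L = [:rconst f, rsigma f:]"
  define N where "N t = L * rden (g t) + rnum (g t)" for t
  define N' where "N' = L * Q' + P'"
  have N': "poly_has_derivative N N'"
    using poly_has_derivative_add[OF poly_has_derivative_mult[OF poly_has_derivative_const Q'] P', of L]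
    by (simp add: N_def[abs_def] N'_def)
  have rtop: "rtop (g t) = N t" if "u0 + (0, 0, axis k t) \<in> U" for t
    using gsb[OF that] by (simp add: rtop_def N_def L_def)
  have N0: "N 0 = rtop f" using rtop[of 0] u0 g0 axis0 by simp
  define W where "W t = pderiv (N t) * rden (g t) - N t * pderiv (rden (g t))" for t
  have rwron: "rwron (g t) = W t" if "u0 + (0, 0, axis k t) \<in> U" for t
    using rtop[OF that] by (simp add: rwron_def W_def)
  have W0: "W 0 = rwron f" using rwron[of 0] u0 g0 axis0 by simp
  obtain W' where W': "poly_has_derivative W W'"
    using poly_has_derivative_diff[OF
      poly_has_derivative_mult[OF poly_has_derivative_pderiv[OF N'] Q']
      poly_has_derivative_mult[OF N' poly_has_derivative_pderiv[OF Q']]]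
    unfolding W_def by blast
  have evU': "eventually (\<lambda>t. u0 + (0, 0, axis k t) \<in> U) (at 0)"
    using evU by (simp add: eventually_at_filter eventually_mono)
  have roots: "poly (rwron f) w = 0 \<longleftrightarrow> w \<in> range c" for w
    using c crit_point_rmap_iff[OF f] by auto

  have a_root: "eventually (\<lambda>t. poly (W t) (a t j) = 0 \<and> order (a t j) (W t) = order (c j) (rwron f)
      \<and> dist (a t j) (c j) < \<epsilon>) (at 0)" for j
    using evU'
  proof eventually_elim
    case (elim t)
    have nf: "normal_form d (g t)" using gnf[OF elim] .
    have "crit_point (rmap (g t)) (a t j)" and
      m: "crit_mult (rmap (g t)) (a t j) = crit_mult (rmap f) (c j)" "dist (a t j) (c j) < \<epsilon>"
      using mark[OF elim] by (auto simp: is_marking_def)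
    thus ?case using crit_point_rmap_iff[OF nf] crit_mult_rmap[OF nf rwron_nonzero[OF d nf]]
      crit_mult_rmap[OF f rwron_nonzero[OF d f]] rwron[OF elim] by simp
  qed
  \<comment> \<open>A marking only confines \<open>a t j\<close> to a fixed disc; convergence
    follows since \<open>c j\<close> is the only root of \<open>rwron f\<close> in the closed
    disc.\<close>
  have a_lim: "((\<lambda>t. a t j) \<longlongrightarrow> c j) (at 0)" for j
  proof (rule tendsto_isolated_zero)
    show "continuous_on (cball (c j) \<epsilon>) (poly (rwron f))" by (intro continuous_intros)
    show "w = c j" if w: "w \<in> cball (c j) \<epsilon>" "poly (rwron f) w = 0" for w
    proof (rule ccontr)
      assume "w \<noteq> c j"
      from w(2) roots obtain i where i: "w = c i" by auto
      with \<open>w \<noteq> c j\<close> have "i \<noteq> j" by auto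
      \<comment> \<open>The open discs are disjoint; a critical point on or inside the boundary
        circle would put the midpoint within \<open>\<epsilon> / 2\<close> of both centres.\<close>
      have "midpoint (c i) (c j) \<in> ball (c i) \<epsilon> \<inter> ball (c j) \<epsilon>"
        using w(1) i eps by (auto simp: dist_midpoint dist_commute)
      with disj \<open>i \<noteq> j\<close> show False by blast
    qed
    show "eventually (\<lambda>t. a t j \<in> cball (c j) \<epsilon>) (at 0)"
      using a_root[of j] by eventually_elim (simp add: dist_commute)
    have "((\<lambda>t. poly (W 0) (a t j)) \<longlongrightarrow> 0) (at 0)"
    proof (rule poly_family_zero_bounded[OF W'])
      show "eventually (\<lambda>t. norm (a t j) \<le> norm (c j) + \<epsilon>) (at 0)"
        using a_root[of j]
      proof eventually_elim
        case (elim t)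
        thus ?case using norm_triangle_sub[of "a t j" "c j"] by (simp add: dist_norm)
      qed
      show "eventually (\<lambda>t. poly (W t) (a t j) = 0) (at 0)"
        using a_root[of j] by eventually_elim simp
    qed
    thus "((\<lambda>t. poly (rwron f) (a t j)) \<longlongrightarrow> 0) (at 0)" by (simp add: W0)
  qed

  \<comment> \<open>The affine part of \<open>g t\<close> is constant, so the quotient rule involves
    only \<open>rnum\<close> and \<open>rden\<close>. This form shows the degree, the next one the
    behaviour at the critical points.\<close>
  define H where "H = P' * rden f - rnum f * Q'"
  have H_eq: "H = N' * rden f - rtop f * Q'"
    by (simp add: H_def N'_def rtop_def L_def algebra_simps)
  have "degree H \<le> 2 * d - 3"
  proof -
    have "degree (P' * rden f) \<le> 2 * d - 3" "degree (rnum f * Q') \<le> 2 * d - 3"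
      using degree_mult_le[of P' "rden f"] degree_mult_le[of "rnum f" Q'] degP degQ f d
      by (auto simp: normal_form_def)
    thus ?thesis unfolding H_def by (rule degree_diff_le)
  qed
  moreover have "dfdv d f c \<epsilon> k u = poly H u / (poly (rden f) u)\<^sup>2" if u: "poly (rden f) u \<noteq> 0" for u
  proof -
    have "((\<lambda>t. poly (rden (g t)) u) \<longlongrightarrow> poly (rden (g 0)) u) (at 0)"
      by (rule poly_has_derivative_tendsto[OF Q' tendsto_const])
    from tendsto_imp_eventually_ne[OF this] u have "eventually (\<lambda>t. poly (rden (g t)) u \<noteq> 0) (nhds 0)"
      by (simp add: eventually_nhds_conv_at g0)
    hence "eventually (\<lambda>t. aff (rmap (g t)) u = poly (N t) u / poly (rden (g t)) u) (nhds 0)"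
      using evU by eventually_elim (simp add: aff_rmap rtop)
    moreover have "((\<lambda>t. poly (N t) u / poly (rden (g t)) u) has_field_derivative
        (poly N' u * poly (rden (g 0)) u - poly (N 0) u * poly Q' u) / (poly (rden (g 0)) u * poly (rden (g 0)) u)) (at 0)"
      using u by (intro DERIV_divide poly_has_derivative_eval N' Q') (simp add: g0)
    ultimately have "((\<lambda>t. aff (rmap (g t)) u) has_field_derivative poly H u / (poly (rden f) u)\<^sup>2) (at 0)"
      by (subst DERIV_cong_ev[OF refl _ refl]) (auto simp: g0 N0 H_eq power2_eq_square)
    thus ?thesis unfolding dfdv_def g_def u0_def by (rule DERIV_imp_deriv)
  qed
  moreover have "[:- c j, 1:] ^ order (c j) (rwron f) dvd H - (if j = k then (rden f)\<^sup>2 else 0)" for j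
  proof (cases "poly (rden f) (c j) = 0")
    case True
    define m where "m = order (c j) (rwron f)"
    have "j \<noteq> k" using True k by auto
    have ord: "order (c j) (rden f) = Suc m"
      using order_rden_at_pole[OF d f True] by (simp add: m_def)
    have "((\<lambda>t. poly (N t) (a t j)) \<longlongrightarrow> poly (N 0) (c j)) (at 0)"
      by (rule poly_has_derivative_tendsto[OF N' a_lim])
    from tendsto_imp_eventually_ne[OF this] have "eventually (\<lambda>t. poly (N t) (a t j) \<noteq> 0) (at 0)"
      using rtop_nonzero_at_pole[OF f True] by (simp add: N0)
    \<comment> \<open>As \<open>j \<noteq> k\<close>, the coordinate with value 0 does not move: the
      critical point stays a pole of the same order.\<close>
    hence "eventually (\<lambda>t. [:- a t j, 1:] ^ Suc m dvd rden (g t)) (at 0)"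
      using evU' a_root[of j]
    proof eventually_elim
      case (elim t)
      have nf: "normal_form d (g t)" using gnf elim by blast
      have "snd (snd (vbar f c \<epsilon> (g t))) $ j = snd (snd u0) $ j"
        using gL(2) elim \<open>j \<noteq> k\<close> by (simp add: axis_def)
      \<comment> \<open>As \<open>recip (Some 0) = 0\<close>, a zero of \<open>g t\<close> has to be excluded; \<open>N t\<close> does not vanish at \<open>a t j\<close>.\<close>
      hence "recip (rmap (g t) (Some (a t j))) = 0"
        using True by (simp add: vbar_def u0_def a_def marking_f)
      hence "poly (rden (g t)) (a t j) = 0"
        using elim rtop[of t] by (simp add: recip_rmap del: rmap.simps)
      from order_rden_at_pole[OF d nf this] elim rwron[of t]
      have "order (a t j) (rden (g t)) = Suc m" by (simp add: m_def)
      thus ?case by (metis order_1)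
    qed
    from poly_family_multiple_root[OF Q' a_lim this] ord
    have "[:- c j, 1:] ^ m dvd Q'"
      using f by (cases "rden f = 0") (auto simp: g0 normal_form_def)
    moreover have "[:- c j, 1:] ^ m dvd rden f"
      using ord by (rule root_power_dvd_if_order_Suc)
    ultimately show ?thesis using \<open>j \<noteq> k\<close> unfolding H_def m_def by (simp add: dvd_diff)
  next
    case False
    define m where "m = order (c j) (rwron f)"
    define v where "v = poly (rtop f) (c j) / poly (rden f) (c j)"
    \<comment> \<open>\<open>e\<close> is the speed of the critical value of index \<open>j\<close>,
      and \<open>A t\<close> below is the numerator of \<open>g t\<close> minus its moving
      value.\<close>
    define e where "e = (if j = k then 1 else 0 :: complex)"
    define A where "A t = N t - [:v + e * t:] * rden (g t)" for t
    have v: "poly (rtop f) (c j) = v * poly (rden f) (c j)" using False by (simp add: v_def)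
    have "poly_has_derivative (\<lambda>t. [:v + e * t:]) [:e:]"
      unfolding poly_has_derivative_def
      by (auto simp: coeff_pCons split: nat.splits intro!: derivative_eq_intros exI[of _ 0])
    from poly_has_derivative_diff[OF N' poly_has_derivative_mult[OF this Q']]
    have A': "poly_has_derivative A (N' - ([:e:] * rden f + [:v:] * Q'))"
      unfolding A_def by (simp add: g0)
    have A0: "A 0 = rtop f - smult v (rden f)" by (simp add: A_def N0 g0)
    have ord: "order (c j) (A 0) = Suc m"
      using order_rtop_minus[OF d f False v] by (simp add: A0 m_def)
    have A0ne: "A 0 \<noteq> 0" using degree_rtop_minus[OF d f, of v] d unfolding A0 by auto
    have "((\<lambda>t. poly (rden (g t)) (a t j)) \<longlongrightarrow> poly (rden (g 0)) (c j)) (at 0)"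
      by (rule poly_has_derivative_tendsto[OF Q' a_lim])
    from tendsto_imp_eventually_ne[OF this] False have "eventually (\<lambda>t. poly (rden (g t)) (a t j) \<noteq> 0) (at 0)"
      by (simp add: g0)
    hence "eventually (\<lambda>t. [:- a t j, 1:] ^ Suc m dvd A t) (at 0)"
      using evU' a_root[of j]
    proof eventually_elim
      case (elim t)
      have nf: "normal_form d (g t)" using gnf elim by blast
      have "snd (snd (vbar f c \<epsilon> (g t))) $ j = snd (snd u0) $ j + e * t"
        using gL(2) elim by (simp add: axis_def e_def)
      hence "aff (rmap (g t)) (a t j) = v + e * t"
        using False by (simp add: vbar_def u0_def a_def marking_f aff_rmap v_def)
      hence "poly (rtop (g t)) (a t j) = (v + e * t) * poly (rden (g t)) (a t j)"
        using elim by (simp add: aff_rmap field_simps)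
      from order_rtop_minus[OF d nf _ this] elim rwron[of t] rtop[of t]
      have "order (a t j) (A t) = Suc m" by (simp add: m_def A_def)
      thus ?case by (metis order_1)
    qed
    from poly_family_multiple_root[OF A' a_lim this A0ne ord]
    have 1: "[:- c j, 1:] ^ m dvd N' - ([:e:] * rden f + [:v:] * Q')" .
    have 2: "[:- c j, 1:] ^ m dvd rtop f - smult v (rden f)"
      using ord unfolding A0 by (rule root_power_dvd_if_order_Suc)
    \<comment> \<open>The terms with \<open>v\<close> cancel, and both brackets vanish to order
      \<open>m\<close> at \<open>c j\<close>.\<close>
    have "H - (if j = k then (rden f)\<^sup>2 else 0) =
        (N' - ([:e:] * rden f + [:v:] * Q')) * rden f - (rtop f - smult v (rden f)) * Q'"
      by (simp add: H_eq e_def power2_eq_square algebra_simps)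
    thus ?thesis using 1 2 unfolding m_def by (simp add: dvd_diff)
  qed
  ultimately show ?thesis by blast
qed

subsection \<open>The partial fraction identity\<close>

text \<open>Written with polynomials instead of \<open>f\<close> and \<open>f'\<close>, the identity
  also covers a pole \<open>y\<close>, where the left side is 0.\<close>

lemma partial_fractions_identity:
  fixes c :: "'n::finite \<Rightarrow> complex" and H :: "'n \<Rightarrow> complex poly"
  assumes d: "d \<ge> 2" and f: "normal_form d f"
    and c: "range c = {w. crit_point (rmap f) w}"
    and x: "\<forall>j. rmap f (Some (c j)) \<noteq> Some x"
    and K: "K = {k. rmap f (Some (c k)) \<noteq> None}"
    and degH: "\<And>k. k \<in> K \<Longrightarrow> degree (H k) \<le> 2 * d - 3"
    and H: "\<And>k j. k \<in> K \<Longrightarrow>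
      [:- c j, 1:] ^ order (c j) (rwron f) dvd H k - (if j = k then (rden f)\<^sup>2 else 0)"
    and y: "poly (rwron f) y \<noteq> 0" "poly (rtop f - smult x (rden f)) y \<noteq> 0"
  shows "poly (rden f) y ^ 3 / (poly (rwron f) y * poly (rtop f - smult x (rden f)) y) =
    (\<Sum>w | rmap f (Some w) = Some x. poly (rden f) w ^ 4 / poly (rwron f) w ^ 2 / (y - w)) +
    (\<Sum>k\<in>K. poly (H k) y / poly (rwron f) y / (aff (rmap f) (c k) - x))"
proof -
  define M where "M = rtop f - smult x (rden f)"
  define Q where "Q = rden f"
  define W where "W = rwron f"
  define Z where "Z = {w. rmap f (Some w) = Some x}"
  define s where "s k = 1 / (aff (rmap f) (c k) - x)" for k
  \<comment> \<open>This is \<open>1 / f'(w)^2\<close>, the residue of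
    \<open>1 / (f' (f - x))\<close> at a preimage \<open>w\<close> of \<open>x\<close>.\<close>
  define r where "r w = poly Q w ^ 4 / poly W w ^ 2" for w
  have W0: "W \<noteq> 0" unfolding W_def by (rule rwron_nonzero[OF d f])
  have degM: "degree M = d" unfolding M_def by (rule degree_rtop_minus[OF d f])
  hence M0: "M \<noteq> 0" using d by auto
  have degW: "degree W = 2 * d - 2" unfolding W_def by (rule degree_rwron[OF d f])
  have degQ: "degree Q = d - 1" using f by (simp add: normal_form_def Q_def)
  have roots: "poly W w = 0 \<longleftrightarrow> w \<in> range c" for w
    using c crit_point_rmap_iff[OF f] by (auto simp: W_def)
  have Z: "w \<in> Z \<longleftrightarrow> poly M w = 0" for w
  proof (cases "poly Q w = 0")
    case True
    thus ?thesis using rtop_nonzero_at_pole[OF f] by (auto simp: Z_def M_def Q_def)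
  next
    case False
    thus ?thesis unfolding Z_def M_def Q_def
      by (simp add: rmap_Some_nonpole field_simps del: rmap.simps)
  qed
  have finZ: "finite Z"
    by (rule finite_subset[OF _ poly_roots_finite[OF M0]]) (use Z in auto)
  have ZQ: "poly Q w \<noteq> 0" if "w \<in> Z" for w using that by (auto simp: Z_def Q_def)
  have ZW: "poly W w \<noteq> 0" if "w \<in> Z" for w
    using that x roots by (force simp: Z_def simp del: rmap.simps)
  have "\<exists>V. M = [:-w, 1:] * V" if "w \<in> Z" for w
    using that Z by (simp add: poly_eq_0_iff_dvd dvd_def)
  then obtain V where V: "\<And>w. w \<in> Z \<Longrightarrow> M = [:-w, 1:] * V w" by metis
  have W_eq: "W = pderiv M * Q - M * pderiv Q"
    by (simp add: W_def M_def Q_def rwron_def pderiv_diff pderiv_smult algebra_simps)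
  have VW: "poly (V w) w * poly Q w = poly W w" if "w \<in> Z" for w
  proof -
    have "poly (pderiv M) w = poly (V w) w"
      by (subst V[OF that]) (simp add: pderiv_mult pderiv_pCons del: mult_pCons_left)
    thus ?thesis using that Z by (simp add: W_eq)
  qed
  define \<Delta> where "\<Delta> = Q ^ 3 - (W * (\<Sum>w\<in>Z. smult (r w) (V w)) + M * (\<Sum>k\<in>K. smult (s k) (H k)))"
  \<comment> \<open>Every term has degree at most \<open>3 * d - 3\<close>, one less than
    \<open>W * M\<close>.\<close>
  have deg\<Delta>: "degree \<Delta> < degree (W * M)"
  proof -
    have "degree (Q ^ 3) \<le> 3 * d - 3"
      using degree_power_le[of Q 3] degQ by simp
    moreover have "degree (W * (\<Sum>w\<in>Z. smult (r w) (V w))) \<le> 3 * d - 3"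
    proof -
      have "degree (V w) \<le> d - 1" if "w \<in> Z" for w
      proof -
        have "V w \<noteq> 0" using V[OF that] M0 by auto
        hence "degree M = 1 + degree (V w)" by (subst V[OF that], subst degree_mult_eq) auto
        thus ?thesis using degM by simp
      qed
      hence "degree (\<Sum>w\<in>Z. smult (r w) (V w)) \<le> d - 1"
        by (intro degree_sum_le finZ) (auto intro: order_trans[OF degree_smult_le])
      thus ?thesis using degree_mult_le[of W "\<Sum>w\<in>Z. smult (r w) (V w)"] degW d by linarith
    qed
    moreover have "degree (M * (\<Sum>k\<in>K. smult (s k) (H k))) \<le> 3 * d - 3"
    proof -
      have "degree (\<Sum>k\<in>K. smult (s k) (H k)) \<le> 2 * d - 3"
        using degH by (intro degree_sum_le) (auto intro: order_trans[OF degree_smult_le])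
      thus ?thesis using degree_mult_le[of M "\<Sum>k\<in>K. smult (s k) (H k)"] degM d by linarith
    qed
    ultimately have "degree \<Delta> \<le> 3 * d - 3"
      unfolding \<Delta>_def by (intro degree_diff_le degree_add_le)
    moreover have "degree (W * M) = 3 * d - 2"
      using degW degM W0 M0 d by (simp add: degree_mult_eq)
    ultimately show ?thesis using d by linarith
  qed
  have dvd_crit: "[:- c j, 1:] ^ order (c j) W dvd \<Delta>" for j
  proof -
    define D where "D = [:- c j, 1:] ^ order (c j) W"
    \<comment> \<open>Removing \<open>Q^2\<close> from the term of index \<open>j\<close> makes
      every summand divisible by \<open>D\<close>.\<close>
    define G where "G = (\<Sum>k\<in>K. smult (s k) (H k - (if j = k then Q\<^sup>2 else 0)))"
    have "D dvd G"
      unfolding G_def D_def W_def Q_def by (intro dvd_sum dvd_smult H)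
    have "D dvd W" unfolding D_def by (rule order_1)
    have G: "(\<Sum>k\<in>K. smult (s k) (H k)) = G + (if j \<in> K then smult (s j) (Q\<^sup>2) else 0)"
    proof -
      have "G = (\<Sum>k\<in>K. smult (s k) (H k)) - (\<Sum>k\<in>K. if j = k then smult (s k) (Q\<^sup>2) else 0)"
        unfolding G_def sum_subtractf[symmetric] by (intro sum.cong) (auto simp: smult_diff_right)
      thus ?thesis by (simp add: sum.delta')
    qed
    have "D dvd Q ^ 3 - M * (\<Sum>k\<in>K. smult (s k) (H k))"
    proof (cases "poly Q (c j) = 0")
      case True
      hence "j \<notin> K" by (simp add: K Q_def)
      have "D dvd Q"
        using order_rden_at_pole[OF d f] True unfolding D_def Q_def W_def
        by (intro root_power_dvd_if_order_Suc) simp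
      hence "D dvd Q ^ 3" by (simp add: power3_eq_cube)
      with \<open>D dvd G\<close> \<open>j \<notin> K\<close> show ?thesis by (simp add: G)
    next
      case False
      define v where "v = poly (rtop f) (c j) / poly Q (c j)"
      have "j \<in> K" using False by (simp add: K Q_def)
      have v: "aff (rmap f) (c j) = v" using False by (simp add: aff_rmap v_def Q_def)
      have "rmap f (Some (c j)) = Some v"
        using False by (simp add: rmap_Some_nonpole v_def Q_def del: rmap.simps)
      hence "v \<noteq> x" using x by auto
      hence sv: "s j * (v - x) = 1" by (simp add: s_def v)
      have "order (c j) (rtop f - smult v Q) = Suc (order (c j) W)"
        unfolding Q_def W_def using False by (intro order_rtop_minus[OF d f]) (auto simp: v_def Q_def)
      hence "D dvd rtop f - smult v Q"
        unfolding D_def by (rule root_power_dvd_if_order_Suc)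
      \<comment> \<open>Uses \<open>M = (N - v Q) + (v - x) Q\<close> with
        \<open>N = rtop f\<close>; since \<open>s j * (v - x) = 1\<close>, the second part cancels
        \<open>Q^3\<close>.\<close>
      moreover have "Q ^ 3 - M * (\<Sum>k\<in>K. smult (s k) (H k)) =
          - (smult (s j) (Q\<^sup>2) * (rtop f - smult v Q)) - M * G"
      proof -
        have "Q ^ 3 = smult (s j * (v - x)) (Q ^ 3)" by (simp add: sv)
        hence "Q ^ 3 - M * smult (s j) (Q\<^sup>2) = - (smult (s j) (Q\<^sup>2) * (rtop f - smult v Q))"
          unfolding M_def Q_def[symmetric]
          by (simp add: algebra_simps power2_eq_square power3_eq_cube smult_diff_left smult_diff_right)
        thus ?thesis using \<open>j \<in> K\<close> by (simp add: G algebra_simps)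
      qed
      ultimately show ?thesis using \<open>D dvd G\<close> by (auto intro!: dvd_diff dvd_smult)
    qed
    with \<open>D dvd W\<close> have "D dvd (Q ^ 3 - M * (\<Sum>k\<in>K. smult (s k) (H k))) - W * (\<Sum>w\<in>Z. smult (r w) (V w))"
      by (meson dvd_diff dvd_mult2)
    thus ?thesis unfolding D_def \<Delta>_def by (simp add: algebra_simps)
  qed
  have root_Z: "poly \<Delta> a = 0" if a: "a \<in> Z" for a
  proof -
    have "poly (V w) a = 0" if "w \<in> Z" "w \<noteq> a" for w
    proof -
      have "poly M a = 0" using a Z by simp
      thus ?thesis by (subst (asm) V[OF that(1)]) (use that(2) in auto)
    qed
    hence "(\<Sum>w\<in>Z. r w * poly (V w) a) = (\<Sum>w\<in>Z. if w = a then r a * poly (V a) a else 0)"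
      by (intro sum.cong) auto
    also have "\<dots> = r a * poly (V a) a" using finZ a by simp
    finally have "poly \<Delta> a = poly Q a ^ 3 - poly W a * (r a * poly (V a) a)"
      using a Z by (simp add: \<Delta>_def poly_sum)
    moreover have "poly W a * (r a * poly (V a) a) = poly Q a ^ 3"
    proof -
      have "poly (V a) a = poly W a / poly Q a" using VW[OF a] ZQ[OF a] by (simp add: field_simps)
      thus ?thesis using ZQ[OF a] ZW[OF a]
        by (simp add: r_def power2_eq_square power3_eq_cube power4_eq_xxxx)
    qed
    ultimately show ?thesis by simp
  qed
  have "\<Delta> = 0"
  proof (rule ccontr)
    assume \<Delta>: "\<Delta> \<noteq> 0"
    \<comment> \<open>As \<open>x\<close> is not a critical value, the roots of \<open>M\<close> are
      simple and are not roots of \<open>W\<close>, so they can be treated separately.\<close>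
    have "order a (W * M) \<le> order a \<Delta>" for a
    proof (cases "a \<in> Z")
      case True
      have "order a M = Suc (order a W)"
        using True ZQ[OF True] Z unfolding W_def M_def Q_def
        by (intro order_rtop_minus[OF d f]) auto
      hence "order a (W * M) = 1"
        using ZW[OF True] W0 M0 by (simp add: order_mult order_0I)
      thus ?thesis using root_Z[OF True] \<Delta> by (simp add: order_root Suc_le_eq)
    next
      case False
      hence "order a M = 0" using Z by (simp add: order_0I)
      hence eq: "order a (W * M) = order a W" using W0 M0 by (simp add: order_mult)
      show ?thesis
      proof (cases "poly W a = 0")
        case True
        with dvd_crit roots \<Delta> eq show ?thesis by (auto simp: order_divides)
      qed (simp add: eq order_0I)
    qed
    from degree_le_if_order_le[OF _ \<Delta> this] W0 M0 deg\<Delta> show False by auto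
  qed
  hence "poly \<Delta> y = 0" by simp
  hence "poly Q y ^ 3 = poly W y * (\<Sum>w\<in>Z. r w * poly (V w) y) + poly M y * (\<Sum>k\<in>K. s k * poly (H k) y)"
    by (simp add: \<Delta>_def poly_sum)
  also have "(\<Sum>w\<in>Z. r w * poly (V w) y) = (\<Sum>w\<in>Z. poly M y * (r w / (y - w)))"
  proof (intro sum.cong refl)
    fix w assume w: "w \<in> Z"
    have "poly M w = 0" using w Z by simp
    with y(2) have "y \<noteq> w" by (auto simp: M_def)
    moreover have "poly M y = (y - w) * poly (V w) y" by (subst V[OF w]) (simp add: algebra_simps)
    ultimately show "r w * poly (V w) y = poly M y * (r w / (y - w))" by simp
  qed
  also have "\<dots> = poly M y * (\<Sum>w\<in>Z. r w / (y - w))" by (simp add: sum_distrib_left)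
  finally have "poly Q y ^ 3 / (poly W y * poly M y) =
      (\<Sum>w\<in>Z. r w / (y - w)) + (\<Sum>k\<in>K. s k * poly (H k) y) / poly W y"
    using y by (simp add: M_def[symmetric] W_def[symmetric] field_simps)
  thus ?thesis
    unfolding Q_def W_def M_def r_def s_def Z_def by (simp add: sum_divide_distrib mult.commute)
qed

section \<open>Comparison of the coefficients of the formal power series\<close>

theorem proposition12:
  fixes d :: nat and f :: ratmap and c :: "'n::finite \<Rightarrow> complex" and \<epsilon> :: real
    and z x :: complex
  assumes "d \<ge> 2" and "normal_form d f"
    and "inj c" and "range c = {w. crit_point (rmap f) w}"
    and "local_coordinate d f c \<epsilon>"
    and "\<forall>n. \<not> crit_point (rmap f ^^ n) z"
    and "\<forall>j. rmap f (Some (c j)) \<noteq> Some x"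
    and "\<forall>n. (rmap f ^^ n) (Some z) \<noteq> Some x"
  shows "phi f z x - fps_X * transfer_fps f (phi f z) x =
    fps_const (1 / (z - x)) +
    (\<Sum>k\<in>{k. rmap f (Some (c k)) \<noteq> None}.
       fps_const (1 / (aff (rmap f) (c k) - x)) * Phi d f c \<epsilon> k z)"
proof (rule fps_ext)
  note d = assms(1) and f = assms(2)
  define K where "K = {k. rmap f (Some (c k)) \<noteq> None}"
  have "\<exists>H. \<forall>k\<in>K. degree (H k) \<le> 2 * d - 3 \<and>
    (\<forall>u. poly (rden f) u \<noteq> 0 \<longrightarrow> dfdv d f c \<epsilon> k u = poly (H k) u / (poly (rden f) u)\<^sup>2) \<and>
    (\<forall>j. [:- c j, 1:] ^ order (c j) (rwron f) dvd H k - (if j = k then (rden f)\<^sup>2 else 0))"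
    unfolding K_def by (intro bchoice ballI dfdv_rational assms) simp
  then obtain H where degH: "\<And>k. k \<in> K \<Longrightarrow> degree (H k) \<le> 2 * d - 3"
    and dfdv: "\<And>k u. k \<in> K \<Longrightarrow> poly (rden f) u \<noteq> 0 \<Longrightarrow> dfdv d f c \<epsilon> k u = poly (H k) u / (poly (rden f) u)\<^sup>2"
    and dvdH: "\<And>k j. k \<in> K \<Longrightarrow> [:- c j, 1:] ^ order (c j) (rwron f) dvd H k - (if j = k then (rden f)\<^sup>2 else 0)"
    by blast
  fix n
  show "fps_nth (phi f z x - fps_X * transfer_fps f (phi f z) x) n =
    fps_nth (fps_const (1 / (z - x)) +
      (\<Sum>k\<in>{k. rmap f (Some (c k)) \<noteq> None}.
         fps_const (1 / (aff (rmap f) (c k) - x)) * Phi d f c \<epsilon> k z)) n"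
  proof (cases n)
    case 0
    have "enat 0 < escape_time f z" by (simp add: less_escape_time_iff del: zero_enat_def)
    moreover have "iter f 0 = (\<lambda>w. w)" by (auto simp: iter_def aff_def)
    ultimately show ?thesis using 0 by (simp add: phi_def Phi_def fps_sum_nth)
  next
    case (Suc m)
    define y where "y = iter f m z"
    define Z where "Z = {w. rmap f (Some w) = Some x}"
    define \<delta> where "\<delta> = deriv (iter f m) z"
    have rhs: "fps_nth (fps_const (1 / (z - x)) +
      (\<Sum>k\<in>{k. rmap f (Some (c k)) \<noteq> None}.
         fps_const (1 / (aff (rmap f) (c k) - x)) * Phi d f c \<epsilon> k z)) n =
      (\<Sum>k\<in>K. 1 / (aff (rmap f) (c k) - x) * fps_nth (Phi d f c \<epsilon> k z) (Suc m))"
      by (simp add: Suc K_def fps_sum_nth)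
    have lhs: "fps_nth (phi f z x - fps_X * transfer_fps f (phi f z) x) n =
      fps_nth (phi f z x) (Suc m) - transfer_op f (\<lambda>w. fps_nth (phi f z w) m) x"
      by (simp add: Suc transfer_fps_def)
    show ?thesis
    proof (cases "enat m < escape_time f z")
      case False
      \<comment> \<open>After escape neither branch of \<open>Phi\<close> contributes, so every term
        of the identity is 0.\<close>
      hence *: "\<not> enat (Suc m) < escape_time f z" "enat (Suc m) \<noteq> escape_time f z"
        using Suc_eq_escape_time_iff[of m f z] by (auto simp: Suc_ile_eq dest: order.strict_implies_order)
      show ?thesis unfolding lhs rhs using False *
        by (simp add: phi_def Phi_def transfer_op_def)
    next
      case m: True
      have \<delta>0: "\<delta> \<noteq> 0" unfolding \<delta>_def using deriv_iter_nonzero[OF m] assms(6) by blast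
      have W: "poly (rwron f) y \<noteq> 0"
        unfolding y_def using rwron_iter_nonzero[OF f m] assms(6) by blast
      have fy: "rmap f (Some y) \<noteq> Some x"
        using assms(8)[rule_format, of "Suc m"] rmap_funpow_Some[OF m] by (simp add: y_def)
      have M: "poly (rtop f - smult x (rden f)) y \<noteq> 0"
      proof (cases "poly (rden f) y = 0")
        case True
        thus ?thesis using rtop_nonzero_at_pole[OF f True] by simp
      next
        case False
        thus ?thesis using fy by (simp add: rmap_Some_nonpole field_simps del: rmap.simps)
      qed
      have id: "poly (rden f) y ^ 3 / (poly (rwron f) y * poly (rtop f - smult x (rden f)) y) =
        (\<Sum>w\<in>Z. poly (rden f) w ^ 4 / poly (rwron f) w ^ 2 / (y - w)) +
        (\<Sum>k\<in>K. poly (H k) y / poly (rwron f) y / (aff (rmap f) (c k) - x))"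
        unfolding Z_def
        by (rule partial_fractions_identity[OF d f assms(4,7) K_def degH dvdH W M])
      \<comment> \<open>The operator acts on the second argument of \<open>phi\<close>, so
        \<open>\<delta>\<close> is the same for all preimages and factors out.\<close>
      have T: "transfer_op f (\<lambda>w. fps_nth (phi f z w) m) x =
        1 / \<delta> * (\<Sum>w\<in>Z. poly (rden f) w ^ 4 / poly (rwron f) w ^ 2 / (y - w))"
        unfolding transfer_op_def sum_distrib_left Z_def
      proof (rule sum.cong[OF refl])
        fix w assume "w \<in> {w. rmap f (Some w) = Some x}"
        hence "poly (rden f) w \<noteq> 0" by auto
        from DERIV_imp_deriv[OF has_field_derivative_aff_rmap[OF this]]
        show "fps_nth (phi f z w) m / (deriv (aff (rmap f)) w)\<^sup>2 =
            1 / \<delta> * (poly (rden f) w ^ 4 / poly (rwron f) w ^ 2 / (y - w))"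
          using m by (simp add: phi_def \<delta>_def y_def power_divide power_mult[symmetric] mult_ac)
      qed
      have P: "fps_nth (phi f z x) (Suc m) =
          1 / \<delta> * (poly (rden f) y ^ 3 / (poly (rwron f) y * poly (rtop f - smult x (rden f)) y))"
      proof (cases "enat (Suc m) < escape_time f z")
        case True
        hence Q: "poly (rden f) y \<noteq> 0" using rden_iter_nonzero_iff[OF m] by (simp add: y_def)
        have "iter f (Suc m) z - x = poly (rtop f - smult x (rden f)) y / poly (rden f) y"
          using iter_Suc[OF m] Q by (simp add: aff_rmap y_def field_simps)
        thus ?thesis using True Q W M deriv_iter_Suc[OF True]
          by (simp add: phi_def \<delta>_def[symmetric] y_def[symmetric] power2_eq_square power3_eq_cube)
      next
        case False
        \<comment> \<open>The orbit escapes at the next step: the coefficient of \<open>phi\<close>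
          is 0, and so is the right side because of the factor \<open>Q(y)^3\<close>.\<close>
        hence "poly (rden f) y = 0" using rden_iter_nonzero_iff[OF m] by (simp add: y_def)
        with False show ?thesis by (simp add: phi_def)
      qed
      have Phi: "fps_nth (Phi d f c \<epsilon> k z) (Suc m) = 1 / \<delta> * (poly (H k) y / poly (rwron f) y)"
        if k: "k \<in> K" for k
      proof (cases "enat (Suc m) < escape_time f z")
        case True
        hence Q: "poly (rden f) y \<noteq> 0" using rden_iter_nonzero_iff[OF m] by (simp add: y_def)
        show ?thesis using True Q W dfdv[OF k Q] deriv_iter_Suc[OF True]
          by (simp add: Phi_def \<delta>_def[symmetric] y_def[symmetric])
      next
        case False
        \<comment> \<open>Off the finitely many poles, \<open>dfdv / f'\<close> equals
          \<open>H k / rwron f\<close>, which is continuous at the pole \<open>y\<close>.\<close>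
        have "((\<lambda>u. poly (H k) u / poly (rwron f) u) \<longlongrightarrow> poly (H k) y / poly (rwron f) y) (at y)"
          using W by (intro tendsto_intros)
        moreover have "eventually (\<lambda>u. poly (H k) u / poly (rwron f) u =
            dfdv d f c \<epsilon> k u / deriv (aff (rmap f)) u) (at y)"
        proof -
          have "rden f \<noteq> 0" using f by (auto simp: normal_form_def)
          hence "finite {u. poly (rden f) u = 0}" by (rule poly_roots_finite)
          hence "eventually (\<lambda>u. u \<notin> {u. poly (rden f) u = 0}) (at y)"
            unfolding eventually_at_topological
            by (intro exI[of _ "- ({u. poly (rden f) u = 0} - {y})"] conjI open_Compl finite_imp_closed) auto
          thus ?thesis
          proof eventually_elim
            case (elim u)
            hence Q: "poly (rden f) u \<noteq> 0" by simp
            show ?case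
              using Q dfdv[OF k Q] DERIV_imp_deriv[OF has_field_derivative_aff_rmap[OF Q]] by simp
          qed
        qed
        ultimately have "((\<lambda>u. dfdv d f c \<epsilon> k u / deriv (aff (rmap f)) u) \<longlongrightarrow> poly (H k) y / poly (rwron f) y) (at y)"
          by (rule Lim_transform_eventually)
        hence "Lim (at y) (\<lambda>u. dfdv d f c \<epsilon> k u / deriv (aff (rmap f)) u) = poly (H k) y / poly (rwron f) y"
          by (intro tendsto_Lim) auto
        moreover have "enat (Suc m) = escape_time f z"
          using False m Suc_eq_escape_time_iff by blast
        ultimately show ?thesis using False by (simp add: Phi_def \<delta>_def y_def)
      qed
      have "fps_nth (phi f z x) (Suc m) - transfer_op f (\<lambda>w. fps_nth (phi f z w) m) x =
          1 / \<delta> * (\<Sum>k\<in>K. poly (H k) y / poly (rwron f) y / (aff (rmap f) (c k) - x))"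
        unfolding P T id by (simp add: algebra_simps)
      also have "\<dots> = (\<Sum>k\<in>K. 1 / (aff (rmap f) (c k) - x) * fps_nth (Phi d f c \<epsilon> k z) (Suc m))"
        unfolding sum_distrib_left by (intro sum.cong) (auto simp: Phi)
      finally show ?thesis unfolding lhs rhs .
    qed
  qed
qed

end
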